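(* Let $(\Omega,\mathcal{F},(\mathcal{F}_t)_{t\ge0},P)$ be a filtered probability space with right-continuous filtration, let $L$ be a random variable taking its values in a Lusin space $(\mathbb{L},\mathcal{L})$ (with Borel $\sigma$-algebra $\mathcal{L}$), and let $\mathcal{G}_t=\bigcap_{s>t}(\mathcal{F}_s\vee\sigma(L))$, $t\ge0$, be the initial enlargement of $(\mathcal{F}_t)$ with $L$. Assume that Jacod's criterion is satisfied: for every $t\ge0$, almost surely $$P_t(\omega,d\ell)\ll P_L(d\ell),$$ where $P_t(\omega,d\ell)=P(L\in d\ell\mid\mathcal{F}_t)(\omega)$ is the regular conditional distribution of $L$ given $\mathcal{F}_t$ and $P_L$ is the distribution of $L$. Then there exists a universal supermartingale density for $(\mathcal{G}_t)$.
   Context: Filtrations are not assumed complete; (super)martingales are understood to be a.s. càdlàg. Let $(\mathcal{G}_t)$ be a filtration with $\mathcal{G}_t\supseteq\mathcal{F}_t$ for all $t\ge0$. A universal supermartingale density for $(\mathcal{G}_t)$ is a $(\mathcal{G}_t)$-adapted, a.s. càdlàg process $Z$ with $P(Z_t>0)=1$ for all $t\ge0$ such that $ZM$ is a $(\mathcal{G}_t)$-supermartingale for every nonnegative $(\mathcal{F}_t)$-supermartingale $M$. *)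

theory Defs
  imports "HOL-Probability.Probability"
begin

text \<open>
  Time is \<^typ>\<open>real\<close>, and every condition is restricted to times \<open>t \<ge> 0\<close>; values at negative
  times are irrelevant. A sub-\<open>\<sigma>\<close>-algebra is represented by a measure of which only \<open>space\<close> and
  \<open>sets\<close> matter, as in \<^const>\<open>subalgebra\<close> and \<^const>\<open>real_cond_exp\<close>. Nothing is assumed complete, and
  ``almost surely'' is \<^const>\<open>almost_everywhere\<close> for the possibly incomplete measure \<open>P\<close>.
\<close>

subsection \<open>Lusin spaces\<close>

text \<open>
  A Lusin space is a Hausdorff space which is the image of a Polish space under a continuous
  bijection; this covers Borel subsets of compact metric spaces. Since the map is a bijection, it
  is no restriction that the Polish topology \<open>Y\<close> lives on the same type.
\<close>

definition Polish_space :: "'l topology \<Rightarrow> bool" where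
  "Polish_space Y \<longleftrightarrow> completely_metrizable_space Y \<and> separable_space Y"

definition Lusin_space :: "'l topology \<Rightarrow> bool" where
  "Lusin_space X \<longleftrightarrow> Hausdorff_space X \<and>
     (\<exists>(Y :: 'l topology) f. Polish_space Y \<and> continuous_map Y X f \<and>
        bij_betw f (topspace Y) (topspace X))"

definition borel_of :: "'l topology \<Rightarrow> 'l measure" where
  "borel_of X = sigma (topspace X) {U. openin X U}"

subsection \<open>Filtrations and initial enlargement\<close>

definition filtration_on :: "'a measure \<Rightarrow> (real \<Rightarrow> 'a measure) \<Rightarrow> bool" where
  "filtration_on P F \<longleftrightarrow> (\<forall>t\<ge>0. subalgebra P (F t)) \<and>
     (\<forall>s t. 0 \<le> s \<longrightarrow> s \<le> t \<longrightarrow> subalgebra (F t) (F s))"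

definition right_continuous_filtration :: "(real \<Rightarrow> 'a measure) \<Rightarrow> bool" where
  "right_continuous_filtration F \<longleftrightarrow> (\<forall>t\<ge>0. sets (F t) = (\<Inter>s\<in>{t<..}. sets (F s)))"

definition initial_enlargement ::
  "'a measure \<Rightarrow> (real \<Rightarrow> 'a measure) \<Rightarrow> ('a \<Rightarrow> 'l) \<Rightarrow> 'l measure \<Rightarrow> real \<Rightarrow> 'a measure" where
  "initial_enlargement P F L N t =
     sigma (space P)
       (\<Inter>s\<in>{t<..}. sigma_sets (space P) (sets (F s) \<union> sets (vimage_algebra (space P) L N)))"

subsection \<open>Supermartingales\<close>

definition cadlag :: "(real \<Rightarrow> real) \<Rightarrow> bool" where
  "cadlag f \<longleftrightarrow> (\<forall>t\<ge>0. continuous (at_right t) f) \<and> (\<forall>t>0. \<exists>l. (f \<longlongrightarrow> l) (at_left t))"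

definition adapted :: "(real \<Rightarrow> 'a measure) \<Rightarrow> (real \<Rightarrow> 'a \<Rightarrow> real) \<Rightarrow> bool" where
  "adapted F X \<longleftrightarrow> (\<forall>t\<ge>0. X t \<in> borel_measurable (F t))"

definition as_cadlag :: "'a measure \<Rightarrow> (real \<Rightarrow> 'a \<Rightarrow> real) \<Rightarrow> bool" where
  "as_cadlag P X \<longleftrightarrow> (AE \<omega> in P. cadlag (\<lambda>t. X t \<omega>))"

definition supermartingale ::
  "'a measure \<Rightarrow> (real \<Rightarrow> 'a measure) \<Rightarrow> (real \<Rightarrow> 'a \<Rightarrow> real) \<Rightarrow> bool" where
  "supermartingale P F X \<longleftrightarrow> adapted F X \<and> as_cadlag P X \<and>
     (\<forall>t\<ge>0. integrable P (X t)) \<and>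
     (\<forall>s t. 0 \<le> s \<longrightarrow> s \<le> t \<longrightarrow> (AE \<omega> in P. real_cond_exp P (F s) (X t) \<omega> \<le> X s \<omega>))"

definition universal_supermartingale_density ::
  "'a measure \<Rightarrow> (real \<Rightarrow> 'a measure) \<Rightarrow> (real \<Rightarrow> 'a measure) \<Rightarrow> (real \<Rightarrow> 'a \<Rightarrow> real) \<Rightarrow> bool" where
  "universal_supermartingale_density P F G Z \<longleftrightarrow> adapted G Z \<and> as_cadlag P Z \<and>
     (\<forall>t\<ge>0. AE \<omega> in P. 0 < Z t \<omega>) \<and>
     (\<forall>M. supermartingale P F M \<longrightarrow> (\<forall>t\<ge>0. AE \<omega> in P. 0 \<le> M t \<omega>) \<longrightarrow>
        supermartingale P G (\<lambda>t \<omega>. Z t \<omega> * M t \<omega>))"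

subsection \<open>Jacod's criterion\<close>

definition regular_conditional_distribution ::
  "'a measure \<Rightarrow> 'a measure \<Rightarrow> ('a \<Rightarrow> 'l) \<Rightarrow> 'l measure \<Rightarrow> ('a \<Rightarrow> 'l measure) \<Rightarrow> bool" where
  "regular_conditional_distribution P F L N K \<longleftrightarrow>
     K \<in> F \<rightarrow>\<^sub>M prob_algebra N \<and>
     (\<forall>B\<in>sets N. AE \<omega> in P.
        measure (K \<omega>) B = real_cond_exp P F (indicator (L -` B \<inter> space P)) \<omega>)"

text \<open>\<open>absolutely_continuous \<mu> \<nu>\<close> means \<open>\<nu> \<lless> \<mu>\<close>.\<close>

definition Jacod_criterion ::
  "'a measure \<Rightarrow> ('a \<Rightarrow> 'l) \<Rightarrow> 'l measure \<Rightarrow> (real \<Rightarrow> 'a \<Rightarrow> 'l measure) \<Rightarrow> bool" where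
  "Jacod_criterion P L N K \<longleftrightarrow>
     (\<forall>t\<ge>0. AE \<omega> in P. absolutely_continuous (distr P N L) (K t \<omega>))"

subsection \<open>The initial enlargement is a filtration containing the original one\<close>

lemma sets_initial_enlargement:
  assumes F: "filtration_on P F" and t: "0 \<le> t"
  shows "sets (initial_enlargement P F L N t) =
    (\<Inter>s\<in>{t<..}. sigma_sets (space P) (sets (F s) \<union> sets (vimage_algebra (space P) L N)))"
    (is "_ = (\<Inter>s\<in>_. ?S s)")
proof -
  have sa: "sigma_algebra (space P) (?S s)" if "s \<in> {t<..}" for s
  proof (rule sigma_algebra_sigma_sets)
    have "subalgebra P (F s)" using F t that by (auto simp: filtration_on_def)
    then have "sets (F s) \<subseteq> Pow (space P)"
      using sets.space_closed[of "F s"] by (simp add: subalgebra_def)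
    moreover have "sets (vimage_algebra (space P) L N) \<subseteq> Pow (space P)"
      using sets.space_closed[of "vimage_algebra (space P) L N"] by simp
    ultimately show "sets (F s) \<union> sets (vimage_algebra (space P) L N) \<subseteq> Pow (space P)"
      by blast
  qed
  have "sigma_algebra (space P) (\<Inter>s\<in>{t<..}. ?S s)"
    unfolding sigma_algebra_iff2
  proof (intro conjI allI ballI impI)
    have "(\<Inter>s\<in>{t<..}. ?S s) \<subseteq> ?S (t + 1)" by (rule INT_lower) simp
    also have "\<dots> \<subseteq> Pow (space P)" using sa[of "t + 1"] by (simp add: sigma_algebra_iff2)
    finally show "(\<Inter>s\<in>{t<..}. ?S s) \<subseteq> Pow (space P)" .
  next
    show "{} \<in> (\<Inter>s\<in>{t<..}. ?S s)" by (rule INT_I) (rule sigma_sets.Empty)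
  next
    fix A assume "A \<in> (\<Inter>s\<in>{t<..}. ?S s)"
    then show "space P - A \<in> (\<Inter>s\<in>{t<..}. ?S s)" by (blast intro: sigma_sets.Compl)
  next
    fix A :: "nat \<Rightarrow> 'a set" assume "range A \<subseteq> (\<Inter>s\<in>{t<..}. ?S s)"
    then show "(\<Union>i. A i) \<in> (\<Inter>s\<in>{t<..}. ?S s)"
      by (intro INT_I sigma_sets.Union) blast
  qed
  then show ?thesis
    by (simp add: initial_enlargement_def sigma_algebra.sets_measure_of_eq)
qed

lemma initial_enlargement_filtration:
  assumes F: "filtration_on P F" and L: "L \<in> P \<rightarrow>\<^sub>M N"
  shows "filtration_on P (initial_enlargement P F L N)"
    and "\<And>t. 0 \<le> t \<Longrightarrow> subalgebra (initial_enlargement P F L N t) (F t)"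
proof -
  let ?G = "initial_enlargement P F L N"
  let ?S = "\<lambda>s. sigma_sets (space P) (sets (F s) \<union> sets (vimage_algebra (space P) L N))"
  note sets_G = sets_initial_enlargement[OF F, of _ L N]
  have space_G: "space (?G t) = space P" for t
    by (simp add: initial_enlargement_def space_measure_of_conv)
  have V: "sets (vimage_algebra (space P) L N) \<subseteq> sets P"
    using L by (auto simp: sets_vimage_algebra2 measurable_space measurable_sets)
  have S: "?S s \<subseteq> sets P" if "0 \<le> s" for s
    using F V that by (intro sets.sigma_sets_subset) (auto simp: filtration_on_def subalgebra_def)
  have GP: "subalgebra P (?G t)" if t: "0 \<le> t" for t
  proof -
    have "sets (?G t) \<subseteq> ?S (t + 1)" using sets_G[OF t] by auto
    also have "\<dots> \<subseteq> sets P" using S[of "t + 1"] t by simp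
    finally show ?thesis by (simp add: subalgebra_def space_G)
  qed
  moreover have "subalgebra (?G t) (?G s)" if "0 \<le> s" "s \<le> t" for s t
  proof -
    have "0 \<le> t" using that by simp
    with that show ?thesis
      by (auto simp: subalgebra_def space_G sets_G)
  qed
  ultimately show "filtration_on P ?G" by (simp add: filtration_on_def)
  show "subalgebra (?G t) (F t)" if t: "0 \<le> t" for t
  proof -
    have "sets (F t) \<subseteq> ?S s" if "s \<in> {t<..}" for s
    proof -
      have "sets (F t) \<subseteq> sets (F s)"
        using F t that by (auto simp: filtration_on_def subalgebra_def)
      then show ?thesis by (auto intro: sigma_sets.Basic)
    qed
    then have "sets (F t) \<subseteq> sets (?G t)" unfolding sets_G[OF t] by (rule INT_greatest)
    moreover have "space (F t) = space P"
      using F t by (auto simp: filtration_on_def subalgebra_def)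
    ultimately show ?thesis by (simp add: subalgebra_def space_G)
  qed
qed

end

theory Submission
  imports Defs
begin

text \<open>
  Jacod's criterion says that on \<open>\<F>\<^sub>t \<otimes> \<L>\<close> the law of \<open>(\<omega>, L \<omega>)\<close> has a density \<open>q\<^sub>t\<close> with respect to
  \<open>P \<otimes> P\<^sub>L\<close>. Put \<open>Y\<^sub>t = 1 / q\<^sub>t(\<cdot>, L)\<close>. Weighting by \<open>Y\<^sub>t\<close> decouples \<open>L\<close> from \<open>\<F>\<^sub>t\<close> up to the event
  \<open>q\<^sub>t > 0\<close>, so that \<open>Y M\<close> decreases in expectation on every set of \<open>\<F>\<^sub>s \<or> \<sigma>(L)\<close> whenever \<open>M\<close> is a
  nonnegative supermartingale. By the upcrossing inequality, \<open>Y\<close> almost surely has finite one-sided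
  limits along the dyadic numbers, and \<open>Z\<close> is its right limit process. Truncating at a constant
  preserves the supermartingale inequality and makes dominated convergence available; hence the
  inequality passes to \<open>Z M\<close>, and \<open>E[Y\<^sub>u; Z\<^sub>t \<le> 0] \<le> E[Z\<^sub>t; Z\<^sub>t \<le> 0] \<le> 0\<close> for \<open>u > t\<close> shows \<open>Z\<^sub>t > 0\<close>.
\<close>

subsection \<open>Upcrossings\<close>

text \<open>The densities \<open>q t\<close> are chosen separately for each \<open>t\<close>.
  Nothing links them across times, so \<open>Y\<close> has no path regularity to start from, and
  path arguments may use only countably many times. Two filtrations are in play: \<open>Y\<close> is
  a supermartingale for the sigma-algebras generated by \<open>F t\<close> and \<open>L\<close>,
  while the target is their right limit. Since null sets cannot be added to either, \<open>Z\<close>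
  has to be measurable on the nose; it is therefore a total \<open>lim\<close> along a deterministic
  sequence of times, not a modification on a good event. Even for a martingale \<open>M\<close> only
  an inequality results, because mass is lost where \<open>q t\<close> vanishes although
  \<open>q s\<close> does not. Truncation is forced by the direction of Fatou's lemma: it bounds the
  expectation of a limit from above, which serves the later time of the inequality, while the
  earlier time needs a bound from below.\<close>

text \<open>
  The strategy holds the asset from the very beginning and sells above \<open>b\<close>, buys below \<open>a\<close>. Because
  of the initial position, the first passage above \<open>b\<close> also counts, so that the upcrossing
  inequality below contains the maximal inequality as the case \<open>a = 0\<close>.
\<close>

primrec holding :: "real \<Rightarrow> real \<Rightarrow> (nat \<Rightarrow> real) \<Rightarrow> nat \<Rightarrow> bool" where
  "holding a b z 0 \<longleftrightarrow> z 0 \<le> b"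
| "holding a b z (Suc k) \<longleftrightarrow> (if holding a b z k then z (Suc k) \<le> b else z (Suc k) < a)"

primrec upcrossings :: "real \<Rightarrow> real \<Rightarrow> (nat \<Rightarrow> real) \<Rightarrow> nat \<Rightarrow> nat" where
  "upcrossings a b z 0 = (if b < z 0 then 1 else 0)"
| "upcrossings a b z (Suc k) =
     upcrossings a b z k + (if holding a b z k \<and> b < z (Suc k) then 1 else 0)"

lemma upcrossings_mono: "i \<le> j \<Longrightarrow> upcrossings a b z i \<le> upcrossings a b z j"
  by (rule lift_Suc_mono_le[of "upcrossings a b z"]) auto

text \<open>A value below \<open>a\<close> forces the asset to be held at \<open>i\<close>, whether
  bought just then or before. From there on either a sale has been counted or the position is still
  open, and then \<open>j\<close> sells it.\<close>

lemma upcrossings_crossing: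
  assumes "i < j" "z i < a" "b < z j" "a \<le> b"
  shows "upcrossings a b z i + 1 \<le> upcrossings a b z j"
proof -
  have start: "holding a b z i"
    using assms by (cases i) auto
  have inv: "upcrossings a b z i < upcrossings a b z k \<or> holding a b z k" if "i \<le> k" for k
    using that by (induction k rule: dec_induct) (auto simp: start intro: le_imp_less_Suc upcrossings_mono)
  \<comment> \<open>Whether \<open>j\<close> counts as a sale is decided by the position at
    \<open>j - 1\<close>.\<close>
  obtain k where k: "j = Suc k" "i \<le> k"
    using assms(1) by (auto dest: less_imp_Suc_add)
  show ?thesis
    using inv[OF k(2)] assms(3) upcrossings_mono[OF k(2), of a b z] by (auto simp: k(1))
qed

text \<open>Here the initial position pays off: it is still open or already sold, so no earlier dip
  below \<open>a\<close> is needed.\<close>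

lemma upcrossings_pos:
  assumes "b < z k"
  shows "0 < upcrossings a b z k"
proof -
  have inv: "0 < upcrossings a b z i \<or> holding a b z i" for i
    by (induction i) auto
  show ?thesis
    using assms inv[of "k - 1"] by (cases k) auto
qed

text \<open>Only coordinates up to \<open>k\<close> enter, so for an adapted process the event is
  known at time \<open>k\<close> and can serve as a test set for the supermartingale
  inequality.\<close>

lemma measurable_holding [measurable (raw)]:
  assumes "\<And>i. i \<le> k \<Longrightarrow> (\<lambda>x. z x i) \<in> borel_measurable M"
  shows "Measurable.pred M (\<lambda>x. holding a b (z x) k)"
  using assms
proof (induction k)
  case 0
  then have [measurable]: "(\<lambda>x. z x 0) \<in> borel_measurable M" by simp
  show ?case by simp
next
  case (Suc k)
  have [measurable]: "(\<lambda>x. z x (Suc k)) \<in> borel_measurable M"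
    "Measurable.pred M (\<lambda>x. holding a b (z x) k)"
    using Suc by auto
  show ?case by simp
qed

lemma measurable_upcrossings [measurable (raw)]:
  assumes "\<And>i. i \<le> k \<Longrightarrow> (\<lambda>x. z x i) \<in> borel_measurable M"
  shows "(\<lambda>x. upcrossings a b (z x) k) \<in> M \<rightarrow>\<^sub>M count_space UNIV"
  using assms
proof (induction k)
  case 0
  then have [measurable]: "(\<lambda>x. z x 0) \<in> borel_measurable M" by simp
  show ?case by simp
next
  case (Suc k)
  have [measurable]: "(\<lambda>x. z x (Suc k)) \<in> borel_measurable M"
    "Measurable.pred M (\<lambda>x. holding a b (z x) k)"
    "(\<lambda>x. upcrossings a b (z x) k) \<in> M \<rightarrow>\<^sub>M count_space UNIV"
    using Suc by (auto intro!: measurable_holding)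
  show ?case by simp
qed

text \<open>\<open>V\<close> is the wealth of the strategy: \<open>b - a\<close> booked per sale,
  plus the asset while held, or a cash reserve \<open>a\<close> otherwise. A sale brings more than
  \<open>b = (b - a) + a\<close>, and a purchase costs less than the reserve; surpluses are
  discarded. Hence wealth can grow only through \<open>z\<close> while the asset is held, and its
  expectation decreases, which makes the bound independent of \<open>n\<close>.\<close>

lemma nn_integral_upcrossings:
  fixes z :: "'a \<Rightarrow> nat \<Rightarrow> real"
  assumes meas: "\<And>i j. i \<le> j \<Longrightarrow> (\<lambda>x. z x i) \<in> borel_measurable (A j)"
    and sub: "\<And>j. subalgebra M (A j)"
    and nonneg: "\<And>x i. 0 \<le> z x i"
    and super: "\<And>k C. C \<in> sets (A k) \<Longrightarrow>
      (\<integral>\<^sup>+x. ennreal (z x (Suc k)) * indicator C x \<partial>M) \<le> (\<integral>\<^sup>+x. ennreal (z x k) * indicator C x \<partial>M)"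
    and ab: "0 \<le> a" "a < b"
  shows "(\<integral>\<^sup>+x. ennreal ((b - a) * real (upcrossings a b (z x) n)) \<partial>M) \<le> (\<integral>\<^sup>+x. ennreal (z x 0) \<partial>M)"
proof -
  define V where "V k x = (b - a) * real (upcrossings a b (z x) k) + (if holding a b (z x) k then z x k else a)" for k x
  have zM [measurable]: "(\<lambda>x. z x i) \<in> borel_measurable M" for i
    using measurable_from_subalg[OF sub meas[OF order_refl]] .
  have step: "(\<integral>\<^sup>+x. ennreal (V (Suc k) x) \<partial>M) \<le> (\<integral>\<^sup>+x. ennreal (V k x) \<partial>M)" for k
  proof -
    \<comment> \<open>\<open>V k\<close> is \<open>R\<close> plus \<open>z k\<close> on
      \<open>H\<close>. Only the second summand moves in the next step, and \<open>H\<close> is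
      known at time \<open>k\<close>.\<close>
    define H where "H = {x \<in> space (A k). holding a b (z x) k}"
    define R where "R x = (b - a) * real (upcrossings a b (z x) k) + (if holding a b (z x) k then 0 else a)" for x
    have spA: "space (A k) = space M" using sub[of k] by (simp add: subalgebra_def)
    have "Measurable.pred (A k) (\<lambda>x. holding a b (z x) k)"
      by (rule measurable_holding) (rule meas)
    then have H: "H \<in> sets (A k)"
      unfolding H_def by measurable
    then have HM [measurable]: "H \<in> sets M"
      using sub[of k] by (auto simp: subalgebra_def)
    have [measurable]: "R \<in> borel_measurable M"
      unfolding R_def by measurable
    have R0: "0 \<le> R x" for x using ab by (simp add: R_def)
    have "(\<integral>\<^sup>+x. ennreal (V (Suc k) x) \<partial>M)
        \<le> (\<integral>\<^sup>+x. ennreal (R x) + ennreal (z x (Suc k)) * indicator H x \<partial>M)"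
    proof (rule nn_integral_mono)
      fix x assume "x \<in> space M"
      then have "V (Suc k) x \<le> R x + z x (Suc k) * indicator H x"
        using ab nonneg[of x "Suc k"]
        by (auto simp: V_def R_def H_def spA indicator_def algebra_simps)
      then show "ennreal (V (Suc k) x) \<le> ennreal (R x) + ennreal (z x (Suc k)) * indicator H x"
        using R0[of x] nonneg[of x "Suc k"]
        by (auto simp: indicator_def ennreal_leI simp flip: ennreal_plus split: if_splits)
    qed
    also have "\<dots> = (\<integral>\<^sup>+x. ennreal (R x) \<partial>M) + (\<integral>\<^sup>+x. ennreal (z x (Suc k)) * indicator H x \<partial>M)"
      by (rule nn_integral_add) auto
    also have "\<dots> \<le> (\<integral>\<^sup>+x. ennreal (R x) \<partial>M) + (\<integral>\<^sup>+x. ennreal (z x k) * indicator H x \<partial>M)"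
      by (intro add_left_mono super H)
    also have "\<dots> = (\<integral>\<^sup>+x. ennreal (R x) + ennreal (z x k) * indicator H x \<partial>M)"
      by (rule nn_integral_add[symmetric]) auto
    also have "\<dots> = (\<integral>\<^sup>+x. ennreal (V k x) \<partial>M)"
      using ab nonneg
      by (intro nn_integral_cong)
        (auto simp: V_def R_def H_def spA indicator_def ennreal_plus)
    finally show ?thesis .
  qed
  have "(\<integral>\<^sup>+x. ennreal ((b - a) * real (upcrossings a b (z x) n)) \<partial>M) \<le> (\<integral>\<^sup>+x. ennreal (V n x) \<partial>M)"
    using ab nonneg by (intro nn_integral_mono ennreal_leI) (auto simp: V_def)
  also have "\<dots> \<le> (\<integral>\<^sup>+x. ennreal (V 0 x) \<partial>M)"
    by (induction n) (auto intro: order_trans[OF step])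
  \<comment> \<open>Either \<open>z 0\<close> is held, or it was sold at once above
    \<open>b\<close>, and then \<open>V 0 = (b - a) + a = b\<close>.\<close>
  also have "\<dots> \<le> (\<integral>\<^sup>+x. ennreal (z x 0) \<partial>M)"
    by (intro nn_integral_mono ennreal_leI) (auto simp: V_def)
  finally show ?thesis .
qed

subsection \<open>Limits along the dyadic numbers\<close>

definition grid_upcrossings :: "real \<Rightarrow> real \<Rightarrow> (real \<Rightarrow> real) \<Rightarrow> nat \<Rightarrow> nat \<Rightarrow> nat" where
  "grid_upcrossings a b y m = upcrossings a b (\<lambda>k. y (real k / 2 ^ m))"

text \<open>Asking for all sufficiently fine grids avoids any comparison between the counters of
  different grids. Only the increment from \<open>u\<close> to \<open>v\<close> matters.\<close>

definition crosses :: "real \<Rightarrow> real \<Rightarrow> (real \<Rightarrow> real) \<Rightarrow> nat \<Rightarrow> real \<Rightarrow> real \<Rightarrow> bool" where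
  "crosses a b y j u v \<longleftrightarrow> (\<forall>\<^sub>F m in sequentially. \<exists>p q. u = real p / 2 ^ m \<and> v = real q / 2 ^ m \<and>
     p \<le> q \<and> grid_upcrossings a b y m p + j \<le> grid_upcrossings a b y m q)"

lemma eventually_on_grid:
  assumes "r \<in> dyadics"
  shows "\<forall>\<^sub>F m in sequentially. \<exists>k. r = real k / 2 ^ m"
proof -
  obtain n k where r: "r = real n / 2 ^ k"
    using assms by (auto simp: dyadics_def)
  show ?thesis
    using eventually_ge_at_top[of k]
  proof eventually_elim
    case (elim m)
    then have "r = real (n * 2 ^ (m - k)) / 2 ^ m"
      by (simp add: r field_simps flip: power_add)
    then show ?case by blast
  qed
qed

text \<open>On a common fine grid the increments add, and the counter cannot drop in the gap from
  \<open>v\<close> to \<open>v'\<close>.\<close>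

lemma crosses_trans:
  assumes "crosses a b y i u v" "crosses a b y j v' w" "v \<le> v'"
  shows "crosses a b y (i + j) u w"
  using assms(1,2) unfolding crosses_def
proof eventually_elim
  case (elim m)
  then obtain p q p' q' where *: "u = real p / 2 ^ m" "v = real q / 2 ^ m" "v' = real p' / 2 ^ m"
    "w = real q' / 2 ^ m" "p \<le> q" "p' \<le> q'"
    "grid_upcrossings a b y m p + i \<le> grid_upcrossings a b y m q"
    "grid_upcrossings a b y m p' + j \<le> grid_upcrossings a b y m q'"
    by blast
  have "q \<le> p'"
    using assms(3) * by (simp add: divide_le_cancel)
  moreover from this have "grid_upcrossings a b y m q \<le> grid_upcrossings a b y m p'"
    by (simp add: grid_upcrossings_def upcrossings_mono)
  ultimately show ?case
    using * by (intro exI[of _ p] exI[of _ q']) auto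
qed

lemma crosses_once:
  assumes "u \<in> dyadics" "v \<in> dyadics" "u < v" "y u < a" "b < y v" "a \<le> b"
  shows "crosses a b y 1 u v"
  unfolding crosses_def
  using eventually_on_grid[OF assms(1)] eventually_on_grid[OF assms(2)]
proof eventually_elim
  case (elim m)
  then obtain p q where pq: "u = real p / 2 ^ m" "v = real q / 2 ^ m" by blast
  then have "p < q" using assms(3) by (simp add: divide_less_cancel)
  moreover have "grid_upcrossings a b y m p + 1 \<le> grid_upcrossings a b y m q"
    unfolding grid_upcrossings_def using assms pq \<open>p < q\<close> by (intro upcrossings_crossing) auto
  ultimately show ?case using pq by (intro exI[of _ p] exI[of _ q]) auto
qed

lemma crosses_zero:
  assumes "u \<in> dyadics"
  shows "crosses a b y 0 u u"
  unfolding crosses_def using eventually_on_grid[OF assms] by eventually_elim auto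

text \<open>Grid \<open>m\<close> is followed up to time \<open>m\<close>, that is, up to index
  \<open>m * 2 ^ m\<close>. Thus one parameter refines the mesh and extends the horizon, and each
  dyadic time is eventually covered.\<close>

lemma grid_index_le:
  assumes "real k / 2 ^ m \<le> real l" "l \<le> m"
  shows "k \<le> m * 2 ^ m"
proof -
  have "real k \<le> real l * 2 ^ m" using assms(1) by (simp add: field_simps)
  also have "\<dots> \<le> real m * 2 ^ m" using assms(2) by (intro mult_right_mono) auto
  also have "\<dots> = real (m * 2 ^ m)" by simp
  finally show ?thesis by (simp only: of_nat_le_iff)
qed

lemma crosses_imp_grid_upcrossings:
  assumes "crosses a b y j u v"
  shows "\<forall>\<^sub>F m in sequentially. j \<le> grid_upcrossings a b y m (m * 2 ^ m)"
proof -
  obtain l where l: "v \<le> real l" using real_arch_simple by blast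
  show ?thesis
    using assms eventually_ge_at_top[of l] unfolding crosses_def
  proof eventually_elim
    case (elim m)
    then obtain p q where pq: "v = real q / 2 ^ m"
      "grid_upcrossings a b y m p + j \<le> grid_upcrossings a b y m q" by blast
    have "q \<le> m * 2 ^ m"
      using pq(1) l elim(2) by (intro grid_index_le[of q m l]) auto
    then have "grid_upcrossings a b y m q \<le> grid_upcrossings a b y m (m * 2 ^ m)"
      by (simp add: grid_upcrossings_def upcrossings_mono)
    then show ?case using pq by linarith
  qed
qed

lemma dyadic_between:
  fixes x y :: real
  assumes "0 \<le> x" "x < y"
  obtains r where "r \<in> dyadics" "x < r" "r < y"
proof -
  obtain m where m: "(1/2) ^ m < y - x"
    using real_arch_pow_inv[of "y - x" "1/2"] assms by auto
  define k where "k = nat (\<lfloor>x * 2 ^ m\<rfloor> + 1)"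
  have k: "real k = \<lfloor>x * 2 ^ m\<rfloor> + 1" using assms by (simp add: k_def)
  have "x * 2 ^ m < real k" "real k \<le> x * 2 ^ m + 1" unfolding k by linarith+
  then have "x < real k / 2 ^ m" "real k / 2 ^ m \<le> x + (1/2) ^ m"
    by (simp_all add: field_simps power_divide)
  moreover have "real k / 2 ^ m \<in> dyadics" by (auto simp: dyadics_def)
  ultimately show ?thesis using m that by fastforce
qed

section \<open>One-sided dyadic neighbourhoods and oscillation\<close>

abbreviation dyadic_right :: "real \<Rightarrow> real filter" where
  "dyadic_right t \<equiv> at t within ({t<..} \<inter> dyadics)"

abbreviation dyadic_left :: "real \<Rightarrow> real filter" where
  "dyadic_left t \<equiv> at t within ({..<t} \<inter> dyadics)"

lemma eventually_dyadic_right: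
  "eventually Q (dyadic_right t) \<longleftrightarrow> (\<exists>c>t. \<forall>r\<in>dyadics. t < r \<longrightarrow> r < c \<longrightarrow> Q r)"
proof
  assume "eventually Q (dyadic_right t)"
  then obtain d where "0 < d" "\<forall>x\<in>{t<..} \<inter> dyadics. x \<noteq> t \<and> dist x t < d \<longrightarrow> Q x"
    by (auto simp: eventually_at)
  then show "\<exists>c>t. \<forall>r\<in>dyadics. t < r \<longrightarrow> r < c \<longrightarrow> Q r"
    by (intro exI[of _ "t + d"]) (auto simp: dist_real_def)
next
  assume "\<exists>c>t. \<forall>r\<in>dyadics. t < r \<longrightarrow> r < c \<longrightarrow> Q r"
  then obtain c where "t < c" "\<forall>r\<in>dyadics. t < r \<longrightarrow> r < c \<longrightarrow> Q r" by blast
  then show "eventually Q (dyadic_right t)"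
    unfolding eventually_at by (intro exI[of _ "c - t"]) (auto simp: dist_real_def)
qed

text \<open>The witness \<open>c\<close> is kept nonnegative because \<open>dyadics\<close> has only
  nonnegative elements, so that \<open>dyadic_between\<close> needs a nonnegative left end.\<close>

lemma eventually_dyadic_left:
  assumes "0 < t"
  shows "eventually Q (dyadic_left t) \<longleftrightarrow> (\<exists>c\<ge>0. c < t \<and> (\<forall>r\<in>dyadics. c < r \<longrightarrow> r < t \<longrightarrow> Q r))"
proof
  assume "eventually Q (dyadic_left t)"
  then obtain d where "0 < d" "\<forall>x\<in>{..<t} \<inter> dyadics. x \<noteq> t \<and> dist x t < d \<longrightarrow> Q x"
    by (auto simp: eventually_at)
  then show "\<exists>c\<ge>0. c < t \<and> (\<forall>r\<in>dyadics. c < r \<longrightarrow> r < t \<longrightarrow> Q r)"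
    using assms by (intro exI[of _ "max 0 (t - d)"]) (auto simp: dist_real_def)
next
  assume "\<exists>c\<ge>0. c < t \<and> (\<forall>r\<in>dyadics. c < r \<longrightarrow> r < t \<longrightarrow> Q r)"
  then obtain c where "c < t" "\<forall>r\<in>dyadics. c < r \<longrightarrow> r < t \<longrightarrow> Q r" by blast
  then show "eventually Q (dyadic_left t)"
    unfolding eventually_at by (intro exI[of _ "t - c"]) (auto simp: dist_real_def)
qed

lemma dyadic_right_nontrivial: "0 \<le> t \<Longrightarrow> dyadic_right t \<noteq> bot"
  unfolding trivial_limit_def eventually_dyadic_right by (auto elim!: dyadic_between)

lemma dyadic_left_nontrivial: "0 < t \<Longrightarrow> dyadic_left t \<noteq> bot"
  unfolding trivial_limit_def by (auto simp: eventually_dyadic_left elim!: dyadic_between)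

lemma frequently_dyadic_rightE:
  assumes "frequently Q (dyadic_right t)" "t < c"
  obtains r where "r \<in> dyadics" "t < r" "r < c" "Q r"
  using assms unfolding frequently_def eventually_dyadic_right by blast

lemma frequently_dyadic_leftE:
  assumes "frequently Q (dyadic_left t)" "0 \<le> c" "c < t"
  obtains r where "r \<in> dyadics" "c < r" "r < t" "Q r"
  using assms unfolding frequently_def by (subst (asm) eventually_dyadic_left) auto

text \<open>Crossings accumulate at \<open>t\<close> and are found last one first: a high point
  \<open>q\<close>, a low point \<open>p\<close> before it, then \<open>j\<close> further crossings
  squeezed between \<open>t\<close> and \<open>p\<close>. This is why \<open>c\<close> varies in the
  induction.\<close>

lemma crosses_right:
  assumes lo: "frequently (\<lambda>r. y r < a) (dyadic_right t)" and hi: "frequently (\<lambda>r. b < y r) (dyadic_right t)"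
    and "a \<le> b" "0 \<le> t" "t < c"
  shows "\<exists>u v. t < u \<and> v < c \<and> crosses a b y j u v"
  using \<open>t < c\<close>
proof (induction j arbitrary: c)
  case 0
  then show ?case
    using dyadic_between[OF \<open>0 \<le> t\<close>, of c] crosses_zero by metis
next
  case (Suc j)
  obtain q where q: "q \<in> dyadics" "t < q" "q < c" "b < y q"
    using frequently_dyadic_rightE[OF hi Suc.prems] .
  obtain p where p: "p \<in> dyadics" "t < p" "p < q" "y p < a"
    using frequently_dyadic_rightE[OF lo q(2)] .
  obtain u v where uv: "t < u" "v < p" "crosses a b y j u v"
    using Suc.IH[OF p(2)] by blast
  have "crosses a b y (j + 1) u q"
    using uv p q assms by (intro crosses_trans[OF uv(3) crosses_once[of p q]]) auto
  then show ?case using uv q by auto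
qed

text \<open>Now time runs towards \<open>t\<close>: the new crossing comes first, and the remaining
  \<open>j\<close> are squeezed between its end and \<open>t\<close>.\<close>

lemma crosses_left:
  assumes lo: "frequently (\<lambda>r. y r < a) (dyadic_left t)" and hi: "frequently (\<lambda>r. b < y r) (dyadic_left t)"
    and "a \<le> b" "0 \<le> c" "c < t"
  shows "\<exists>u v. c < u \<and> v < t \<and> crosses a b y j u v"
  using \<open>0 \<le> c\<close> \<open>c < t\<close>
proof (induction j arbitrary: c)
  case 0
  then show ?case
    using dyadic_between[of c t] crosses_zero by metis
next
  case (Suc j)
  obtain p where p: "p \<in> dyadics" "c < p" "p < t" "y p < a"
    using frequently_dyadic_leftE[OF lo Suc.prems] .
  obtain q where q: "q \<in> dyadics" "p < q" "q < t" "b < y q"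
    using frequently_dyadic_leftE[OF hi, of p] p Suc.prems by force
  obtain u v where uv: "q < u" "v < t" "crosses a b y j u v"
    using Suc.IH[of q] Suc.prems p q by force
  have "crosses a b y (1 + j) p v"
    using uv p q assms by (intro crosses_trans[OF crosses_once[of p q] uv(3)]) auto
  then show ?case using uv p by auto
qed

text \<open>A gap between lower and upper limit would contain two rationals that are crossed over
  and over. Rational levels suffice, so later only countably many null sets arise. Both limits are
  taken in \<open>ereal\<close>, where they exist unconditionally; the bounds make them
  finite.\<close>

lemma convergent_if_no_oscillation:
  fixes y :: "'a \<Rightarrow> real"
  assumes "\<Phi> \<noteq> bot" and bd: "\<forall>\<^sub>F r in \<Phi>. 0 \<le> y r \<and> y r \<le> c"
    and no: "\<And>a b. a \<in> \<rat> \<Longrightarrow> b \<in> \<rat> \<Longrightarrow> 0 \<le> a \<Longrightarrow> a < b \<Longrightarrow>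
      \<not> (frequently (\<lambda>r. y r < a) \<Phi> \<and> frequently (\<lambda>r. b < y r) \<Phi>)"
  shows "\<exists>l. (y \<longlongrightarrow> l) \<Phi>"
proof -
  define f where "f r = ereal (y r)" for r
  have lo: "0 \<le> Liminf \<Phi> f"
    by (rule Liminf_bounded) (use bd in \<open>eventually_elim, simp add: f_def\<close>)
  have hi: "Limsup \<Phi> f \<le> ereal c"
    by (rule Limsup_bounded) (use bd in \<open>eventually_elim, simp add: f_def\<close>)
  have le: "Liminf \<Phi> f \<le> Limsup \<Phi> f"
    by (rule Liminf_le_Limsup) fact
  have eq: "Limsup \<Phi> f = Liminf \<Phi> f"
  proof (rule ccontr)
    assume "Limsup \<Phi> f \<noteq> Liminf \<Phi> f"
    with le have "Liminf \<Phi> f < Limsup \<Phi> f" by simp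
    moreover obtain l u where lu: "Liminf \<Phi> f = ereal l" "Limsup \<Phi> f = ereal u"
      using lo hi le by (cases "Liminf \<Phi> f"; cases "Limsup \<Phi> f") auto
    ultimately have "l < u" by simp
    then obtain a b where ab: "a \<in> \<rat>" "b \<in> \<rat>" "l < a" "a < b" "b < u"
      by (meson Rats_dense_in_real)
    have "0 \<le> a" using lo lu ab by simp
    have "frequently (\<lambda>r. y r < a) \<Phi>"
    proof (rule ccontr)
      assume "\<not> frequently (\<lambda>r. y r < a) \<Phi>"
      then have "eventually (\<lambda>r. ereal a \<le> f r) \<Phi>"
        by (simp add: not_frequently f_def not_less)
      then have "ereal a \<le> Liminf \<Phi> f" by (rule Liminf_bounded)
      then show False using lu ab by simp
    qed
    moreover have "frequently (\<lambda>r. b < y r) \<Phi>"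
    proof (rule ccontr)
      assume "\<not> frequently (\<lambda>r. b < y r) \<Phi>"
      then have "eventually (\<lambda>r. f r \<le> ereal b) \<Phi>"
        by (simp add: not_frequently f_def not_less)
      then have "Limsup \<Phi> f \<le> ereal b" by (rule Limsup_bounded)
      then show False using lu ab by simp
    qed
    ultimately show False using no[OF ab(1,2) \<open>0 \<le> a\<close> ab(4)] by blast
  qed
  obtain l where l: "Liminf \<Phi> f = ereal l"
    using lo hi eq by (cases "Liminf \<Phi> f") auto
  have "(f \<longlongrightarrow> ereal l) \<Phi>"
    using assms(1) l eq by (intro Liminf_eq_Limsup) auto
  then show ?thesis unfolding f_def lim_ereal by blast
qed

text \<open>The value at \<open>t\<close> itself does not enter. With all \<open>t\<close> inside
  the path property, a single null set serves every time.\<close>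

definition dyadic_regular :: "(real \<Rightarrow> real) \<Rightarrow> bool" where
  "dyadic_regular y \<longleftrightarrow> (\<forall>t\<ge>0. \<exists>l. (y \<longlongrightarrow> l) (dyadic_right t)) \<and> (\<forall>t>0. \<exists>l. (y \<longlongrightarrow> l) (dyadic_left t))"

text \<open>Bounds on infinitely many grids are what a \<open>liminf\<close> delivers, and they
  suffice: a path that exceeds \<beta> or oscillates has too many upcrossings on every fine
  grid.\<close>

lemma dyadic_regularI:
  assumes nonneg: "\<And>t. 0 \<le> y t"
    and bound: "\<exists>\<^sub>F m in sequentially. grid_upcrossings 0 \<beta> y m (m * 2 ^ m) = 0"
    and osc: "\<And>a b. a \<in> \<rat> \<Longrightarrow> b \<in> \<rat> \<Longrightarrow> 0 \<le> a \<Longrightarrow> a < b \<Longrightarrow>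
      \<exists>c. \<exists>\<^sub>F m in sequentially. grid_upcrossings a b y m (m * 2 ^ m) < c"
  shows "dyadic_regular y"
proof -
  have bd: "y r \<le> \<beta>" if r: "r \<in> dyadics" for r
  proof (rule ccontr)
    assume "\<not> y r \<le> \<beta>"
    obtain l where l: "r \<le> real l" using real_arch_simple by blast
    have "\<forall>\<^sub>F m in sequentially. 0 < grid_upcrossings 0 \<beta> y m (m * 2 ^ m)"
      using eventually_on_grid[OF r] eventually_ge_at_top[of l]
    proof eventually_elim
      case (elim m)
      then obtain k where k: "r = real k / 2 ^ m" by blast
      have "k \<le> m * 2 ^ m"
        using k l elim(2) by (intro grid_index_le[of k m l]) auto
      then have "grid_upcrossings 0 \<beta> y m k \<le> grid_upcrossings 0 \<beta> y m (m * 2 ^ m)"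
        by (simp add: grid_upcrossings_def upcrossings_mono)
      moreover have "0 < grid_upcrossings 0 \<beta> y m k"
        using \<open>\<not> y r \<le> \<beta>\<close> k unfolding grid_upcrossings_def by (intro upcrossings_pos) auto
      ultimately show ?case by linarith
    qed
    then show False using bound by (simp add: frequently_def)
  qed
  have no: False if ab: "a \<in> \<rat>" "b \<in> \<rat>" "0 \<le> a" "a < b" and cr: "\<And>j. \<exists>u v. crosses a b y j u v" for a b
  proof -
    obtain c where c: "\<exists>\<^sub>F m in sequentially. grid_upcrossings a b y m (m * 2 ^ m) < c"
      using osc[OF ab] by blast
    obtain u v where "crosses a b y c u v" using cr by blast
    from crosses_imp_grid_upcrossings[OF this] c show False
      by (simp add: frequently_def not_less)
  qed
  show ?thesis
    unfolding dyadic_regular_def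
  proof (intro conjI allI impI)
    fix t :: real assume t: "0 \<le> t"
    show "\<exists>l. (y \<longlongrightarrow> l) (dyadic_right t)"
    proof (rule convergent_if_no_oscillation[OF dyadic_right_nontrivial[OF t]])
      show "\<forall>\<^sub>F r in dyadic_right t. 0 \<le> y r \<and> y r \<le> \<beta>"
        unfolding eventually_dyadic_right using bd nonneg by (intro exI[of _ "t + 1"]) auto
    next
      fix a b :: real assume ab: "a \<in> \<rat>" "b \<in> \<rat>" "0 \<le> a" "a < b"
      show "\<not> (frequently (\<lambda>r. y r < a) (dyadic_right t) \<and> frequently (\<lambda>r. b < y r) (dyadic_right t))"
        using no[OF ab] crosses_right[of y a t b "t + 1"] ab t by (metis less_add_one less_imp_le)
    qed
  next
    fix t :: real assume t: "0 < t"
    show "\<exists>l. (y \<longlongrightarrow> l) (dyadic_left t)"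
    proof (rule convergent_if_no_oscillation[OF dyadic_left_nontrivial[OF t]])
      show "\<forall>\<^sub>F r in dyadic_left t. 0 \<le> y r \<and> y r \<le> \<beta>"
        unfolding eventually_dyadic_left[OF t] using bd nonneg t by (intro exI[of _ 0]) auto
    next
      fix a b :: real assume ab: "a \<in> \<rat>" "b \<in> \<rat>" "0 \<le> a" "a < b"
      show "\<not> (frequently (\<lambda>r. y r < a) (dyadic_left t) \<and> frequently (\<lambda>r. b < y r) (dyadic_left t))"
        using no[OF ab] crosses_left[of y a t b 0] ab t by (metis less_imp_le order_refl)
    qed
  qed
qed

subsection \<open>Regularity of nonnegative supermartingales\<close>

text \<open>Testing on sets with nonnegative integrals asks for no integrability and passes directly
  through Fubini and Fatou. Negative values count as 0 under \<open>ennreal\<close>, which is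
  harmless for processes that are nonnegative almost surely.\<close>

definition setwise_supermartingale ::
  "'a measure \<Rightarrow> (real \<Rightarrow> 'a measure) \<Rightarrow> (real \<Rightarrow> 'a \<Rightarrow> real) \<Rightarrow> bool" where
  "setwise_supermartingale P J Y \<longleftrightarrow> adapted J Y \<and>
     (\<forall>s t C. 0 \<le> s \<longrightarrow> s \<le> t \<longrightarrow> C \<in> sets (J s) \<longrightarrow>
        (\<integral>\<^sup>+\<omega>. ennreal (Y t \<omega>) * indicator C \<omega> \<partial>P) \<le> (\<integral>\<^sup>+\<omega>. ennreal (Y s \<omega>) * indicator C \<omega> \<partial>P))"

lemma frequently_less_of_liminf:
  fixes f :: "nat \<Rightarrow> ennreal"
  assumes "liminf f < c"
  shows "\<exists>\<^sub>F n in sequentially. f n < c"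
proof (rule ccontr)
  assume "\<not> ?thesis"
  then have "\<forall>\<^sub>F n in sequentially. c \<le> f n" by (simp add: not_frequently not_less)
  then have "c \<le> liminf f" by (rule Liminf_bounded)
  with assms show False by simp
qed

lemma adapted_measurable:
  assumes "filtration_on P J" "adapted J Y" "0 \<le> t"
  shows "Y t \<in> borel_measurable P"
  using assms by (auto simp: filtration_on_def adapted_def intro: measurable_from_subalg)

text \<open>The upcrossing bound is the same on every grid, so Fatou transfers it to the
  \<open>liminf\<close> over grids, without monotonicity in \<open>m\<close>. A finite expectation
  excludes oscillation for each rational pair; the levels \<open>a = 0\<close> act as a maximal
  inequality and exclude unbounded paths.\<close>

lemma AE_dyadic_regular:
  assumes "prob_space P" and J: "filtration_on P J" and Y: "setwise_supermartingale P J Y"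
    and nonneg: "\<And>t \<omega>. 0 \<le> Y t \<omega>" and fin: "(\<integral>\<^sup>+\<omega>. ennreal (Y 0 \<omega>) \<partial>P) < \<infinity>"
  shows "AE \<omega> in P. dyadic_regular (\<lambda>t. Y t \<omega>)"
proof -
  interpret prob_space P by fact
  define U where "U a b m \<omega> = grid_upcrossings a b (\<lambda>t. Y t \<omega>) m (m * 2 ^ m)" for a b m \<omega>
  define G where "G a b \<omega> = liminf (\<lambda>m. ennreal ((b - a) * real (U a b m \<omega>)))" for a b \<omega>
  define e where "e = (\<integral>\<^sup>+\<omega>. ennreal (Y 0 \<omega>) \<partial>P)"
  have [measurable]: "Y t \<in> borel_measurable P" if "0 \<le> t" for t
    using adapted_measurable[OF J _ that] Y by (auto simp: setwise_supermartingale_def)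
  have U_meas [measurable]: "U a b m \<in> P \<rightarrow>\<^sub>M count_space UNIV" for a b m
    unfolding U_def grid_upcrossings_def by measurable
  have G_meas [measurable]: "G a b \<in> borel_measurable P" for a b
    unfolding G_def by measurable
  have U_le: "(\<integral>\<^sup>+\<omega>. ennreal ((b - a) * real (U a b m \<omega>)) \<partial>P) \<le> e" if "0 \<le> a" "a < b" for a b m
  proof -
    let ?z = "\<lambda>\<omega> k. Y (real k / 2 ^ m) \<omega>" and ?A = "\<lambda>k. J (real k / 2 ^ m)"
    have "(\<integral>\<^sup>+\<omega>. ennreal ((b - a) * real (upcrossings a b (?z \<omega>) (m * 2 ^ m))) \<partial>P)
        \<le> (\<integral>\<^sup>+\<omega>. ennreal (?z \<omega> 0) \<partial>P)"
    proof (rule nn_integral_upcrossings[where A = ?A])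
      fix i j :: nat assume "i \<le> j"
      then have "subalgebra (?A j) (?A i)"
        using J by (auto simp: filtration_on_def divide_right_mono)
      moreover have "(\<lambda>\<omega>. ?z \<omega> i) \<in> borel_measurable (?A i)"
        using Y by (auto simp: setwise_supermartingale_def adapted_def)
      ultimately show "(\<lambda>\<omega>. ?z \<omega> i) \<in> borel_measurable (?A j)"
        by (rule measurable_from_subalg)
    next
      show "subalgebra P (?A j)" for j
        using J by (auto simp: filtration_on_def)
    next
      fix k C assume "C \<in> sets (?A k)"
      then show "(\<integral>\<^sup>+x. ennreal (?z x (Suc k)) * indicator C x \<partial>P)
          \<le> (\<integral>\<^sup>+x. ennreal (?z x k) * indicator C x \<partial>P)"
        using Y by (auto simp: setwise_supermartingale_def divide_right_mono)
    qed (use that nonneg in auto)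
    then show ?thesis by (simp add: U_def grid_upcrossings_def e_def)
  qed
  have G_le: "(\<integral>\<^sup>+\<omega>. G a b \<omega> \<partial>P) \<le> e" if "0 \<le> a" "a < b" for a b
  proof -
    have "(\<integral>\<^sup>+\<omega>. G a b \<omega> \<partial>P) \<le> liminf (\<lambda>m. \<integral>\<^sup>+\<omega>. ennreal ((b - a) * real (U a b m \<omega>)) \<partial>P)"
      unfolding G_def by (rule nn_integral_liminf) measurable
    also have "\<dots> \<le> e"
      using Liminf_mono[of "\<lambda>m. \<integral>\<^sup>+\<omega>. ennreal ((b - a) * real (U a b m \<omega>)) \<partial>P" "\<lambda>_. e" sequentially] U_le[OF that]
      by (simp add: Liminf_const)
    finally show ?thesis .
  qed
  have osc: "AE \<omega> in P. \<forall>(a, b)\<in>{(a, b). a \<in> \<rat> \<and> b \<in> \<rat> \<and> 0 \<le> a \<and> a < b}. G a b \<omega> \<noteq> \<infinity>"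
  proof (subst AE_ball_countable)
    have "countable (\<rat> \<times> \<rat> :: (real \<times> real) set)" by (simp add: countable_rat)
    then show "countable {(a, b). a \<in> \<rat> \<and> b \<in> \<rat> \<and> 0 \<le> a \<and> a < (b::real)}"
      by (rule countable_subset[rotated]) auto
    have "AE \<omega> in P. G a b \<omega> \<noteq> \<infinity>" if "0 \<le> a" "a < b" for a b
      using G_le[OF that] fin unfolding e_def by (intro nn_integral_PInf_AE) auto
    then show "\<forall>y\<in>{(a, b). a \<in> \<rat> \<and> b \<in> \<rat> \<and> 0 \<le> a \<and> a < b}. AE \<omega> in P. case y of (a, b) \<Rightarrow> G a b \<omega> \<noteq> \<infinity>"
      by auto
  qed
  \<comment> \<open>One upcrossing of \<open>[0, Suc n]\<close> contributes exactly
    \<open>Suc n\<close>, so a path outside \<open>S\<close> has, for some \<open>n\<close>,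
    infinitely many grids on which it never exceeds \<open>Suc n\<close>. Using \<open>Suc n\<close>
    keeps the upper level positive.\<close>
  define S where "S = {\<omega> \<in> space P. \<forall>n. ennreal (real (Suc n)) \<le> G 0 (real (Suc n)) \<omega>}"
  have [measurable]: "S \<in> sets P" unfolding S_def by measurable
  have S: "ennreal (real (Suc n)) * emeasure P S \<le> e" for n
  proof -
    have "ennreal (real (Suc n)) * emeasure P S = (\<integral>\<^sup>+\<omega>. ennreal (real (Suc n)) * indicator S \<omega> \<partial>P)"
      by (simp add: nn_integral_cmult_indicator)
    also have "\<dots> \<le> (\<integral>\<^sup>+\<omega>. G 0 (real (Suc n)) \<omega> \<partial>P)"
      by (intro nn_integral_mono) (auto simp: S_def indicator_def simp del: of_nat_Suc)
    also have "\<dots> \<le> e" by (rule G_le) auto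
    finally show ?thesis .
  qed
  have "measure P S = 0"
  proof (rule ccontr)
    assume "measure P S \<noteq> 0"
    then have "0 < measure P S" by (simp add: zero_less_measure_iff)
    then obtain n where n: "enn2real e < real n * measure P S"
      using reals_Archimedean3 by blast
    have e: "e = ennreal (enn2real e)" using fin by (simp add: e_def)
    have "ennreal (real (Suc n) * measure P S) \<le> ennreal (enn2real e)"
      using S[of n] e by (simp add: emeasure_eq_measure ennreal_mult del: of_nat_Suc)
    then have "real (Suc n) * measure P S \<le> enn2real e"
      by (simp add: ennreal_le_iff)
    moreover have "real n * measure P S \<le> real (Suc n) * measure P S"
      by (intro mult_right_mono) auto
    ultimately show False using n by linarith
  qed
  then have "AE \<omega> in P. \<omega> \<notin> S"
    by (intro AE_not_in) (simp add: null_sets_def emeasure_eq_measure)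
  then show ?thesis
    using osc AE_space
  proof eventually_elim
    case (elim \<omega>)
    then obtain n where n: "G 0 (real (Suc n)) \<omega> < ennreal (real (Suc n))"
      unfolding S_def by (auto simp: not_le simp del: of_nat_Suc)
    show ?case
    proof (rule dyadic_regularI[OF nonneg, where \<beta> = "real (Suc n)"])
      show "\<exists>\<^sub>F m in sequentially. grid_upcrossings 0 (real (Suc n)) (\<lambda>t. Y t \<omega>) m (m * 2 ^ m) = 0"
        using frequently_less_of_liminf[OF n[unfolded G_def]]
      proof (rule frequently_elim1)
        fix m assume "ennreal ((real (Suc n) - 0) * real (U 0 (real (Suc n)) m \<omega>)) < ennreal (real (Suc n))"
        then have "real (Suc n) * real (U 0 (real (Suc n)) m \<omega>) < real (Suc n)"
          by (simp add: ennreal_less_iff del: of_nat_Suc)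
        then have "real (Suc n) * real (U 0 (real (Suc n)) m \<omega>) < real (Suc n) * 1" by simp
        then have "real (U 0 (real (Suc n)) m \<omega>) < 1"
          by (subst (asm) mult_less_cancel_left_pos) auto
        then have "U 0 (real (Suc n)) m \<omega> = 0" by simp
        then show "grid_upcrossings 0 (real (Suc n)) (\<lambda>t. Y t \<omega>) m (m * 2 ^ m) = 0"
          by (simp add: U_def)
      qed
    next
      fix a b :: real assume ab: "a \<in> \<rat>" "b \<in> \<rat>" "0 \<le> a" "a < b"
      then have "G a b \<omega> < \<infinity>" using elim(2) by (auto simp: less_top)
      then obtain r where r: "0 \<le> r" "G a b \<omega> < ennreal r"
        by (metis ennreal_Ex_less_of_nat ennreal_of_nat_eq_real_of_nat infinity_ennreal_def of_nat_0_le_iff)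
      obtain c where c: "r / (b - a) \<le> real c" using real_arch_simple by blast
      show "\<exists>c. \<exists>\<^sub>F m in sequentially. grid_upcrossings a b (\<lambda>t. Y t \<omega>) m (m * 2 ^ m) < c"
        using frequently_less_of_liminf[OF r(2)[unfolded G_def]]
      proof (intro exI[of _ c], elim frequently_elim1)
        fix m assume "ennreal ((b - a) * real (U a b m \<omega>)) < ennreal r"
        then have "(b - a) * real (U a b m \<omega>) < r"
          using ab by (simp add: ennreal_less_iff)
        then have "real (U a b m \<omega>) < r / (b - a)"
          using ab by (simp add: field_simps)
        then show "grid_upcrossings a b (\<lambda>t. Y t \<omega>) m (m * 2 ^ m) < c"
          using c unfolding U_def by linarith
      qed
    qed
  qed
qed

subsection \<open>Right limits\<close>

text \<open>The \<open>+ 1\<close> makes this strictly larger than \<open>t\<close> even if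
  \<open>t\<close> is dyadic, so the value at \<open>t\<close> never enters the limit.\<close>

definition dyadic_above :: "nat \<Rightarrow> real \<Rightarrow> real" where
  "dyadic_above n t = real_of_int (\<lfloor>t * 2 ^ n\<rfloor> + 1) / 2 ^ n"

text \<open>\<open>lim\<close> along a fixed sequence is total and measurable even on paths without
  a limit, so no null set has to be removed.\<close>

definition right_limit :: "(real \<Rightarrow> real) \<Rightarrow> real \<Rightarrow> real" where
  "right_limit y t = lim (\<lambda>n. y (dyadic_above n t))"

lemma dyadic_above_greater: "t < dyadic_above n t"
proof -
  have "t * 2 ^ n < real_of_int (\<lfloor>t * 2 ^ n\<rfloor> + 1)" by linarith
  then show ?thesis by (simp add: dyadic_above_def field_simps)
qed

lemma dyadic_above_le: "dyadic_above n t \<le> t + (1/2) ^ n"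
proof -
  have "real_of_int (\<lfloor>t * 2 ^ n\<rfloor> + 1) \<le> t * 2 ^ n + 1" by linarith
  then have "real_of_int (\<lfloor>t * 2 ^ n\<rfloor> + 1) / 2 ^ n \<le> (t * 2 ^ n + 1) / 2 ^ n"
    by (rule divide_right_mono) simp
  then show ?thesis by (simp add: dyadic_above_def add_divide_distrib power_divide)
qed

lemma dyadic_above_dyadic:
  assumes "0 \<le> t"
  shows "dyadic_above n t \<in> dyadics"
proof -
  have "dyadic_above n t = real (nat (\<lfloor>t * 2 ^ n\<rfloor> + 1)) / 2 ^ n"
    using assms by (simp add: dyadic_above_def)
  then show ?thesis unfolding dyadics_def by blast
qed

lemma eventually_dyadic_above_less:
  assumes "t < c"
  shows "\<forall>\<^sub>F n in sequentially. dyadic_above n t < c"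
proof -
  have "(\<lambda>n. t + (1/2) ^ n :: real) \<longlonglongrightarrow> t + 0"
    by (intro tendsto_add tendsto_const LIMSEQ_power_zero) auto
  then have "\<forall>\<^sub>F n in sequentially. t + (1/2) ^ n < c"
    using assms by (intro order_tendstoD(2)[of _ "t + 0"]) auto
  then show ?thesis
    by eventually_elim (use dyadic_above_le in \<open>rule le_less_trans\<close>)
qed

lemma filterlim_dyadic_above_dyadic_right:
  assumes "0 \<le> t"
  shows "filterlim (\<lambda>n. dyadic_above n t) (dyadic_right t) sequentially"
  unfolding filterlim_iff eventually_dyadic_right
proof safe
  fix Q c assume "t < c" "\<forall>r\<in>dyadics. t < r \<longrightarrow> r < c \<longrightarrow> Q r"
  with eventually_dyadic_above_less[OF \<open>t < c\<close>] show "\<forall>\<^sub>F n in sequentially. Q (dyadic_above n t)"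
    by (auto elim!: eventually_mono simp: dyadic_above_greater dyadic_above_dyadic assms)
qed

lemma filterlim_dyadic_above_at_right: "filterlim (\<lambda>n. dyadic_above n t) (at_right t) sequentially"
  unfolding filterlim_iff eventually_at_right_field
proof safe
  fix Q c assume "t < c" "\<forall>r>t. r < c \<longrightarrow> Q r"
  with eventually_dyadic_above_less[OF \<open>t < c\<close>] show "\<forall>\<^sub>F n in sequentially. Q (dyadic_above n t)"
    by (auto elim!: eventually_mono simp: dyadic_above_greater)
qed

lemma tendsto_right_limit:
  assumes "dyadic_regular y" "0 \<le> t"
  shows "(y \<longlongrightarrow> right_limit y t) (dyadic_right t)"
    and "(\<lambda>n. y (dyadic_above n t)) \<longlonglongrightarrow> right_limit y t"
proof -
  obtain l where l: "(y \<longlongrightarrow> l) (dyadic_right t)"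
    using assms by (auto simp: dyadic_regular_def)
  have *: "(\<lambda>n. y (dyadic_above n t)) \<longlonglongrightarrow> l"
    by (rule filterlim_compose[OF l filterlim_dyadic_above_dyadic_right[OF assms(2)]])
  then have "right_limit y t = l" by (simp add: right_limit_def limI)
  with l * show "(y \<longlongrightarrow> right_limit y t) (dyadic_right t)"
    "(\<lambda>n. y (dyadic_above n t)) \<longlonglongrightarrow> right_limit y t" by auto
qed

text \<open>Closed balls survive limits, so an estimate at the dyadics just above \<open>u\<close>
  passes to \<open>u\<close> with only strictness lost; the next proof therefore starts from
  \<open>e / 2\<close>.\<close>

lemma right_limit_cball:
  assumes y: "dyadic_regular y" and "0 \<le> u"
    and ev: "\<forall>\<^sub>F r in dyadic_right u. dist l (y r) < e"
  shows "dist (right_limit y u) l \<le> e"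
proof -
  have "right_limit y u \<in> cball l e"
    by (rule Lim_in_closed_set[OF closed_cball _ dyadic_right_nontrivial[OF \<open>0 \<le> u\<close>]
        tendsto_right_limit(1)[OF y \<open>0 \<le> u\<close>]])
      (use ev in \<open>eventually_elim, simp\<close>)
  then show ?thesis by (simp add: dist_commute)
qed

text \<open>For \<open>u\<close> near \<open>t\<close> on one side, the dyadics slightly above
  \<open>u\<close> are still near \<open>t\<close> on that side, so the dyadic limits of
  \<open>y\<close> at \<open>t\<close> govern \<open>right_limit y\<close> as well.\<close>

lemma cadlag_right_limit:
  assumes y: "dyadic_regular y"
  shows "cadlag (right_limit y)"
  unfolding cadlag_def
proof (intro conjI allI impI)
  fix t :: real assume t: "0 \<le> t"
  have "(right_limit y \<longlongrightarrow> right_limit y t) (at_right t)"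
  proof (rule tendstoI)
    fix e :: real assume "0 < e"
    then have "\<forall>\<^sub>F r in dyadic_right t. dist (y r) (right_limit y t) < e / 2"
      using tendstoD[OF tendsto_right_limit(1)[OF y t], of "e / 2"] by simp
    then obtain c where c: "t < c" "\<forall>r\<in>dyadics. t < r \<longrightarrow> r < c \<longrightarrow> dist (y r) (right_limit y t) < e / 2"
      unfolding eventually_dyadic_right by blast
    show "\<forall>\<^sub>F u in at_right t. dist (right_limit y u) (right_limit y t) < e"
      unfolding eventually_at_right_field
    proof (intro exI[of _ c] conjI allI impI c)
      fix u assume u: "t < u" "u < c"
      have "dist (right_limit y u) (right_limit y t) \<le> e / 2"
        using u t c by (intro right_limit_cball[OF y])
          (auto simp: eventually_dyadic_right dist_commute intro!: exI[of _ c])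
      then show "dist (right_limit y u) (right_limit y t) < e" using \<open>0 < e\<close> by simp
    qed
  qed
  then show "continuous (at_right t) (right_limit y)" by (simp add: continuous_within)
next
  fix t :: real assume t: "0 < t"
  then obtain l where l: "(y \<longlongrightarrow> l) (dyadic_left t)"
    using y by (auto simp: dyadic_regular_def)
  have "(right_limit y \<longlongrightarrow> l) (at_left t)"
  proof (rule tendstoI)
    fix e :: real assume "0 < e"
    then have "\<forall>\<^sub>F r in dyadic_left t. dist (y r) l < e / 2"
      using tendstoD[OF l, of "e / 2"] by simp
    then obtain c where c: "0 \<le> c" "c < t" "\<forall>r\<in>dyadics. c < r \<longrightarrow> r < t \<longrightarrow> dist (y r) l < e / 2"
      unfolding eventually_dyadic_left[OF t] by blast
    show "\<forall>\<^sub>F u in at_left t. dist (right_limit y u) l < e"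
      unfolding eventually_at_left_field
    proof (intro exI[of _ c] conjI allI impI c)
      fix u assume u: "c < u" "u < t"
      have "dist (right_limit y u) l \<le> e / 2"
        \<comment> \<open>The approximating dyadics are kept below \<open>t\<close>, where the
          left-hand estimate applies.\<close>
        using u c by (intro right_limit_cball[OF y])
          (auto simp: eventually_dyadic_right dist_commute intro!: exI[of _ t])
      then show "dist (right_limit y u) l < e" using \<open>0 < e\<close> by simp
    qed
  qed
  then show "\<exists>l. (right_limit y \<longlongrightarrow> l) (at_left t)" by blast
qed

text \<open>A tail of the approximating times lies before \<open>s\<close>, and the tail alone
  determines the limit.\<close>

lemma right_limit_measurable:
  assumes "filtration_on P J" "adapted J Y" "0 \<le> t" "t < s"
  shows "(\<lambda>\<omega>. right_limit (\<lambda>t. Y t \<omega>) t) \<in> borel_measurable (J s)"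
proof -
  obtain N where N: "\<And>n. N \<le> n \<Longrightarrow> dyadic_above n t < s"
    using eventually_dyadic_above_less[OF assms(4)] by (auto simp: eventually_sequentially)
  \<comment> \<open>This covers divergent sequences too: a sequence and its tail have the same
    limits, hence the same \<open>lim\<close>.\<close>
  have shift: "lim f = lim (\<lambda>n. f (n + N))" for f :: "nat \<Rightarrow> real"
    unfolding lim_def using LIMSEQ_ignore_initial_segment LIMSEQ_offset by metis
  have [measurable]: "Y (dyadic_above (n + N) t) \<in> borel_measurable (J s)" for n
  proof (rule measurable_from_subalg)
    have "0 \<le> dyadic_above (n + N) t" using dyadic_above_greater[of t "n + N"] assms by linarith
    then show "Y (dyadic_above (n + N) t) \<in> borel_measurable (J (dyadic_above (n + N) t))"
      "subalgebra (J s) (J (dyadic_above (n + N) t))"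
      using assms N[of "n + N"] by (auto simp: adapted_def filtration_on_def)
  qed
  show ?thesis
    unfolding right_limit_def by (subst shift) measurable
qed

section \<open>Passing set integrals to right limits\<close>

lemma nn_integral_le_of_tendsto:
  fixes f :: "nat \<Rightarrow> 'a \<Rightarrow> ennreal"
  assumes "\<And>n. f n \<in> borel_measurable M" "AE x in M. (\<lambda>n. f n x) \<longlonglongrightarrow> g x"
    and "\<forall>\<^sub>F n in sequentially. (\<integral>\<^sup>+x. f n x \<partial>M) \<le> B"
  shows "(\<integral>\<^sup>+x. g x \<partial>M) \<le> B"
proof -
  have "(\<integral>\<^sup>+x. g x \<partial>M) = (\<integral>\<^sup>+x. liminf (\<lambda>n. f n x) \<partial>M)"
    using assms(2) by (intro nn_integral_cong_AE) (auto elim!: eventually_mono dest: lim_imp_Liminf[rotated])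
  also have "\<dots> \<le> liminf (\<lambda>n. \<integral>\<^sup>+x. f n x \<partial>M)"
    by (rule nn_integral_liminf) fact
  also have "\<dots> \<le> liminf (\<lambda>n. B)"
    by (rule Liminf_mono) fact
  finally show ?thesis by (simp add: Liminf_const)
qed

text \<open>Jensen's inequality for \<open>min\<close> with a constant, by splitting
  \<open>C\<close> at time \<open>s\<close>: where \<open>W s\<close> is at most \<open>k\<close>
  the supermartingale inequality applies, elsewhere the truncated later value is at most
  \<open>k\<close>, which is the truncated earlier value.\<close>

lemma setwise_supermartingale_truncated:
  assumes J: "filtration_on P J" and W: "setwise_supermartingale P J W"
    and st: "0 \<le> s" "s \<le> t" and C: "C \<in> sets (J s)"
  shows "(\<integral>\<^sup>+\<omega>. min (ennreal (W t \<omega>)) k * indicator C \<omega> \<partial>P)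
    \<le> (\<integral>\<^sup>+\<omega>. min (ennreal (W s \<omega>)) k * indicator C \<omega> \<partial>P)"
proof -
  have WM [measurable]: "W u \<in> borel_measurable P" if "0 \<le> u" for u
    using adapted_measurable[OF J _ that] W by (auto simp: setwise_supermartingale_def)
  have [measurable]: "W s \<in> borel_measurable P" "W t \<in> borel_measurable P"
    using WM st by auto
  have sub: "subalgebra P (J s)" using J st by (auto simp: filtration_on_def)
  define D where "D = {\<omega> \<in> space (J s). ennreal (W s \<omega>) \<le> k}"
  have [measurable]: "W s \<in> borel_measurable (J s)"
    using W st by (auto simp: setwise_supermartingale_def adapted_def)
  have D: "C \<inter> D \<in> sets (J s)" "C - D \<in> sets (J s)"
    using C unfolding D_def by measurable
  have DP [measurable]: "C \<inter> D \<in> sets P" "C - D \<in> sets P" "C \<in> sets P"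
    using D C sub by (auto simp: subalgebra_def)
  have "(\<integral>\<^sup>+\<omega>. min (ennreal (W t \<omega>)) k * indicator C \<omega> \<partial>P)
      \<le> (\<integral>\<^sup>+\<omega>. ennreal (W t \<omega>) * indicator (C \<inter> D) \<omega> + k * indicator (C - D) \<omega> \<partial>P)"
    by (intro nn_integral_mono) (auto simp: indicator_def)
  also have "\<dots> = (\<integral>\<^sup>+\<omega>. ennreal (W t \<omega>) * indicator (C \<inter> D) \<omega> \<partial>P) + (\<integral>\<^sup>+\<omega>. k * indicator (C - D) \<omega> \<partial>P)"
    by (rule nn_integral_add) auto
  also have "\<dots> \<le> (\<integral>\<^sup>+\<omega>. ennreal (W s \<omega>) * indicator (C \<inter> D) \<omega> \<partial>P) + (\<integral>\<^sup>+\<omega>. k * indicator (C - D) \<omega> \<partial>P)"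
    using W st D(1) by (intro add_right_mono) (auto simp: setwise_supermartingale_def)
  also have "\<dots> = (\<integral>\<^sup>+\<omega>. ennreal (W s \<omega>) * indicator (C \<inter> D) \<omega> + k * indicator (C - D) \<omega> \<partial>P)"
    by (rule nn_integral_add[symmetric]) auto
  also have "\<dots> = (\<integral>\<^sup>+\<omega>. min (ennreal (W s \<omega>)) k * indicator C \<omega> \<partial>P)"
    using sub by (intro nn_integral_cong) (auto simp: indicator_def D_def subalgebra_def min_def)
  finally show ?thesis .
qed

text \<open>Fatou points the wrong way here. Truncated values are dominated by a constant, so their
  integrals converge as the times decrease to \<open>s\<close>; the truncation is lifted at the end.
  \<open>C\<close> has to be known only after \<open>s\<close>, which is what membership in the
  enlarged sigma-algebra at \<open>s\<close> provides.\<close>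

lemma nn_integral_le_right_limit:
  assumes "prob_space P" and J: "filtration_on P J" and W: "setwise_supermartingale P J W"
    and s: "0 \<le> s" "s < t" and C: "\<And>u. s < u \<Longrightarrow> C \<in> sets (J u)"
    and Ws [measurable]: "Ws \<in> borel_measurable P"
    and lim: "AE \<omega> in P. (\<lambda>n. W (dyadic_above n s) \<omega>) \<longlonglongrightarrow> Ws \<omega>"
  shows "(\<integral>\<^sup>+\<omega>. ennreal (W t \<omega>) * indicator C \<omega> \<partial>P) \<le> (\<integral>\<^sup>+\<omega>. ennreal (Ws \<omega>) * indicator C \<omega> \<partial>P)"
proof -
  interpret prob_space P by fact
  have WM [measurable]: "W u \<in> borel_measurable P" if "0 \<le> u" for u
    using adapted_measurable[OF J _ that] W by (auto simp: setwise_supermartingale_def)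
  have [measurable]: "W t \<in> borel_measurable P" using s by (intro WM) auto
  have [measurable]: "W (dyadic_above n s) \<in> borel_measurable P" for n
    using s dyadic_above_greater[of s n] by (intro WM) auto
  have "subalgebra P (J t)" using J s by (auto simp: filtration_on_def)
  then have [measurable]: "C \<in> sets P" using C[OF s(2)] by (auto simp: subalgebra_def)
  have trunc: "(\<integral>\<^sup>+\<omega>. min (ennreal (W t \<omega>)) (of_nat k) * indicator C \<omega> \<partial>P)
      \<le> (\<integral>\<^sup>+\<omega>. ennreal (Ws \<omega>) * indicator C \<omega> \<partial>P)" for k
  proof -
    let ?f = "\<lambda>n \<omega>. min (ennreal (W (dyadic_above n s) \<omega>)) (of_nat k) * indicator C \<omega>"
    have "(\<lambda>n. \<integral>\<^sup>+\<omega>. ?f n \<omega> \<partial>P) \<longlonglongrightarrow> (\<integral>\<^sup>+\<omega>. min (ennreal (Ws \<omega>)) (of_nat k) * indicator C \<omega> \<partial>P)"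
    proof (rule nn_integral_dominated_convergence[where w = "\<lambda>_. of_nat k"])
      show "AE \<omega> in P. (\<lambda>n. ?f n \<omega>) \<longlonglongrightarrow> min (ennreal (Ws \<omega>)) (of_nat k) * indicator C \<omega>"
        using lim
      proof eventually_elim
        case (elim \<omega>)
        then have "(\<lambda>n. min (ennreal (W (dyadic_above n s) \<omega>)) (of_nat k)) \<longlonglongrightarrow> min (ennreal (Ws \<omega>)) (of_nat k)"
          by (intro tendsto_min tendsto_ennrealI tendsto_const)
        then show ?case by (auto simp: indicator_def)
      qed
    qed (auto simp: indicator_def emeasure_space_1 of_nat_less_top)
    moreover have "\<forall>\<^sub>F n in sequentially.
        (\<integral>\<^sup>+\<omega>. min (ennreal (W t \<omega>)) (of_nat k) * indicator C \<omega> \<partial>P) \<le> (\<integral>\<^sup>+\<omega>. ?f n \<omega> \<partial>P)"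
      using eventually_dyadic_above_less[OF s(2)]
    proof eventually_elim
      case (elim n)
      then show ?case
        using s dyadic_above_greater[of s n]
        by (intro setwise_supermartingale_truncated[OF J W] C) auto
    qed
    ultimately have "(\<integral>\<^sup>+\<omega>. min (ennreal (W t \<omega>)) (of_nat k) * indicator C \<omega> \<partial>P)
        \<le> (\<integral>\<^sup>+\<omega>. min (ennreal (Ws \<omega>)) (of_nat k) * indicator C \<omega> \<partial>P)"
      by (rule tendsto_lowerbound) simp
    also have "\<dots> \<le> (\<integral>\<^sup>+\<omega>. ennreal (Ws \<omega>) * indicator C \<omega> \<partial>P)"
      by (intro nn_integral_mono) (auto simp: indicator_def)
    finally show ?thesis .
  qed
  show ?thesis
  proof (rule nn_integral_le_of_tendsto)
    show "AE \<omega> in P. (\<lambda>k. min (ennreal (W t \<omega>)) (of_nat k) * indicator C \<omega>) \<longlonglongrightarrow> ennreal (W t \<omega>) * indicator C \<omega>"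
    proof (rule AE_I2)
      fix \<omega>
      \<comment> \<open>\<open>W t\<close> is real-valued, so at each point the truncation is
        inactive from some level on.\<close>
      obtain k where "W t \<omega> \<le> real k" using real_arch_simple by blast
      then have k: "ennreal (W t \<omega>) \<le> of_nat k"
        by (simp add: ennreal_of_nat_eq_real_of_nat ennreal_leI)
      have "\<forall>\<^sub>F i in sequentially. min (ennreal (W t \<omega>)) (of_nat i) * indicator C \<omega> = ennreal (W t \<omega>) * indicator C \<omega>"
        using eventually_ge_at_top[of k]
      proof eventually_elim
        case (elim i)
        then have "ennreal (W t \<omega>) \<le> of_nat i"
          using k by (meson of_nat_mono order_trans)
        then show ?case by (simp add: min_def)
      qed
      then show "(\<lambda>k. min (ennreal (W t \<omega>)) (of_nat k) * indicator C \<omega>) \<longlonglongrightarrow> ennreal (W t \<omega>) * indicator C \<omega>"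
        by (rule tendsto_eventually)
    qed
  qed (use trunc in auto)
qed

text \<open>Fatou handles the limit at \<open>t\<close>, the preceding lemma the one at
  \<open>s\<close>. The times \<open>dyadic_above n t\<close> exceed \<open>s\<close> strictly even
  if \<open>s = t\<close>.\<close>

lemma nn_integral_right_limit_mono:
  assumes "prob_space P" and J: "filtration_on P J" and W: "setwise_supermartingale P J W"
    and s: "0 \<le> s" "s \<le> t" and C: "\<And>u. s < u \<Longrightarrow> C \<in> sets (J u)"
    and Ws: "Ws \<in> borel_measurable P"
    and lims: "AE \<omega> in P. (\<lambda>n. W (dyadic_above n s) \<omega>) \<longlonglongrightarrow> Ws \<omega>"
    and limt: "AE \<omega> in P. (\<lambda>n. W (dyadic_above n t) \<omega>) \<longlonglongrightarrow> Wt \<omega>"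
  shows "(\<integral>\<^sup>+\<omega>. ennreal (Wt \<omega>) * indicator C \<omega> \<partial>P) \<le> (\<integral>\<^sup>+\<omega>. ennreal (Ws \<omega>) * indicator C \<omega> \<partial>P)"
proof (rule nn_integral_le_of_tendsto)
  show "AE \<omega> in P. (\<lambda>n. ennreal (W (dyadic_above n t) \<omega>) * indicator C \<omega>) \<longlonglongrightarrow> ennreal (Wt \<omega>) * indicator C \<omega>"
    using limt by eventually_elim (auto simp: indicator_def intro: tendsto_ennrealI)
next
  have "subalgebra P (J (s + 1))" using J s by (auto simp: filtration_on_def)
  then have [measurable]: "C \<in> sets P" using C[of "s + 1"] by (auto simp: subalgebra_def)
  fix n
  have "0 \<le> dyadic_above n t" using s dyadic_above_greater[of t n] by linarith
  then have [measurable]: "W (dyadic_above n t) \<in> borel_measurable P"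
    using adapted_measurable[OF J _ ] W by (auto simp: setwise_supermartingale_def)
  show "(\<lambda>\<omega>. ennreal (W (dyadic_above n t) \<omega>) * indicator C \<omega>) \<in> borel_measurable P"
    by measurable
next
  show "\<forall>\<^sub>F n in sequentially. (\<integral>\<^sup>+\<omega>. ennreal (W (dyadic_above n t) \<omega>) * indicator C \<omega> \<partial>P)
      \<le> (\<integral>\<^sup>+\<omega>. ennreal (Ws \<omega>) * indicator C \<omega> \<partial>P)"
    using s dyadic_above_greater[of t]
    by (intro always_eventually allI nn_integral_le_right_limit[OF assms(1) J W s(1) _ C Ws lims])
      (auto intro: le_less_trans)
qed

subsection \<open>The joint density under Jacod's criterion\<close>

lemma subalgebra_pair_measure:
  assumes "subalgebra P F"
  shows "subalgebra (P \<Otimes>\<^sub>M N) (F \<Otimes>\<^sub>M N)"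
  using assms unfolding subalgebra_def space_pair_measure sets_pair_measure
  by (auto intro!: sigma_sets_mono')

text \<open>The identity defining \<open>K\<close> holds off a null set depending on
  \<open>B\<close>. On a rectangle this is absorbed by integrating over \<open>A\<close>, and a
  Dynkin argument then reaches all product-measurable sets.\<close>

lemma emeasure_joint_law:
  assumes "prob_space P" and F: "subalgebra P F" and L [measurable]: "L \<in> P \<rightarrow>\<^sub>M N"
    and K: "regular_conditional_distribution P F L N K"
    and D: "D \<in> sets (F \<Otimes>\<^sub>M N)"
  shows "emeasure P {\<omega> \<in> space P. (\<omega>, L \<omega>) \<in> D} = (\<integral>\<^sup>+\<omega>. emeasure (K \<omega>) (Pair \<omega> -` D) \<partial>P)"
proof -
  interpret prob_space P by fact
  interpret F: finite_measure_subalgebra P F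
    by standard (rule F)
  have space_F: "space F = space P" using F by (simp add: subalgebra_def)
  have K_meas: "K \<in> F \<rightarrow>\<^sub>M prob_algebra N"
    using K by (simp add: regular_conditional_distribution_def)
  have K_sets: "sets (K \<omega>) = sets N" and K_prob: "prob_space (K \<omega>)" if "\<omega> \<in> space P" for \<omega>
    using measurable_space[OF K_meas] that by (auto simp: space_F space_prob_algebra)
  have pairs: "(\<lambda>\<omega>. (\<omega>, L \<omega>)) \<in> P \<rightarrow>\<^sub>M F \<Otimes>\<^sub>M N"
    using measurable_from_subalg[OF F, of "\<lambda>\<omega>. \<omega>" F] by (intro measurable_Pair) (auto simp: L)
  have joint [measurable]: "{\<omega> \<in> space P. (\<omega>, L \<omega>) \<in> E} \<in> sets P" if "E \<in> sets (F \<Otimes>\<^sub>M N)" for E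
    using measurable_sets[OF pairs that] by (simp add: vimage_def Int_def conj_commute)
  have slice_meas: "(\<lambda>\<omega>. emeasure (K \<omega>) (Pair \<omega> -` E)) \<in> borel_measurable P"
    if E: "E \<in> sets (F \<Otimes>\<^sub>M N)" for E
  proof -
    have "(SIGMA \<omega>:space F. Pair \<omega> -` E) = E"
      using sets.sets_into_space[OF E] by (auto simp: space_pair_measure)
    then have "(\<lambda>\<omega>. emeasure (K \<omega>) (Pair \<omega> -` E)) \<in> borel_measurable F"
      using E by (intro emeasure_measurable_subprob_algebra2[OF _ measurable_prob_algebraD[OF K_meas]]) simp
    then show ?thesis by (rule measurable_from_subalg[OF F])
  qed
  let ?G = "{A \<times> B | A B. A \<in> sets F \<and> B \<in> sets N}"
  have sets_FN: "sets (F \<Otimes>\<^sub>M N) = sigma_sets (space F \<times> space N) ?G"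
    by (rule sets_pair_measure)
  show ?thesis
    using Int_stable_pair_measure_generator pair_measure_closed D[unfolded sets_FN]
  proof (induction rule: sigma_sets_induct_disjoint)
    case (basic D)
    then obtain A B where AB: "D = A \<times> B" "A \<in> sets F" "B \<in> sets N" by auto
    have [measurable]: "A \<in> sets P" using AB F by (auto simp: subalgebra_def)
    have [measurable]: "L -` B \<inter> space P \<in> sets P" using AB(3) by measurable
    have A_sub: "A \<subseteq> space P" using sets.sets_into_space[OF \<open>A \<in> sets P\<close>] .
    have meas: "(\<lambda>\<omega>. measure (K \<omega>) B) \<in> borel_measurable P"
      by (rule measurable_from_subalg[OF F])
        (rule measurable_compose[OF K_meas measurable_measure_prob_algebra[OF AB(3)]])
    have int: "integrable P (\<lambda>\<omega>. indicator A \<omega> * measure (K \<omega>) B)"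
    proof (rule integrable_const_bound[where B = 1])
      show "AE \<omega> in P. norm (indicator A \<omega> * measure (K \<omega>) B) \<le> 1"
        using prob_space.prob_le_1[OF K_prob] by (auto simp: indicator_def)
      show "(\<lambda>\<omega>. indicator A \<omega> * measure (K \<omega>) B) \<in> borel_measurable P"
        using meas by measurable
    qed
    have "emeasure P {\<omega> \<in> space P. (\<omega>, L \<omega>) \<in> D} = emeasure P (A \<inter> (L -` B \<inter> space P))"
      using A_sub by (intro arg_cong[where f = "emeasure P"]) (auto simp: AB)
    also have "\<dots> = ennreal (\<integral>\<omega>\<in>A. indicator (L -` B \<inter> space P) \<omega> \<partial>P)"
      by (simp add: emeasure_eq_measure set_lebesgue_integral_def flip: indicator_inter_arith)
    also have "(\<integral>\<omega>\<in>A. indicator (L -` B \<inter> space P) \<omega> \<partial>P)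
        = (\<integral>\<omega>\<in>A. real_cond_exp P F (indicator (L -` B \<inter> space P)) \<omega> \<partial>P)"
      using AB by (intro F.real_cond_exp_intA integrable_real_indicator) (auto simp: less_top[symmetric])
    also have "\<dots> = (\<integral>\<omega>. indicator A \<omega> * measure (K \<omega>) B \<partial>P)"
      unfolding set_lebesgue_integral_def
    proof (rule integral_cong_AE)
      have "AE \<omega> in P. measure (K \<omega>) B = real_cond_exp P F (indicator (L -` B \<inter> space P)) \<omega>"
        using K AB by (auto simp: regular_conditional_distribution_def)
      then show "AE \<omega> in P. indicator A \<omega> *\<^sub>R real_cond_exp P F (indicator (L -` B \<inter> space P)) \<omega>
          = indicator A \<omega> * measure (K \<omega>) B"
        by eventually_elim simp
    qed (use meas in measurable)
    also have "ennreal \<dots> = (\<integral>\<^sup>+\<omega>. ennreal (indicator A \<omega> * measure (K \<omega>) B) \<partial>P)"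
      by (rule nn_integral_eq_integral[symmetric, OF int]) auto
    also have "\<dots> = (\<integral>\<^sup>+\<omega>. emeasure (K \<omega>) (Pair \<omega> -` D) \<partial>P)"
    proof (rule nn_integral_cong)
      fix \<omega> assume "\<omega> \<in> space P"
      then interpret K: prob_space "K \<omega>" by (rule K_prob)
      show "ennreal (indicator A \<omega> * measure (K \<omega>) B) = emeasure (K \<omega>) (Pair \<omega> -` D)"
        by (auto simp: AB K.emeasure_eq_measure indicator_def)
    qed
    finally show ?case .
  next
    case empty
    show ?case by simp
  next
    case (compl D)
    have D [measurable]: "D \<in> sets (F \<Otimes>\<^sub>M N)" using compl by (simp add: sets_FN)
    have "emeasure P {\<omega> \<in> space P. (\<omega>, L \<omega>) \<in> space F \<times> space N - D}
        = emeasure P (space P - {\<omega> \<in> space P. (\<omega>, L \<omega>) \<in> D})"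
      using measurable_space[OF L]
      by (intro arg_cong[where f = "emeasure P"]) (auto simp: space_F)
    also have "\<dots> = 1 - emeasure P {\<omega> \<in> space P. (\<omega>, L \<omega>) \<in> D}"
      by (subst emeasure_compl) (auto simp: emeasure_space_1)
    also have "\<dots> = (\<integral>\<^sup>+\<omega>. 1 \<partial>P) - (\<integral>\<^sup>+\<omega>. emeasure (K \<omega>) (Pair \<omega> -` D) \<partial>P)"
      by (simp add: compl emeasure_space_1)
    also have "\<dots> = (\<integral>\<^sup>+\<omega>. 1 - emeasure (K \<omega>) (Pair \<omega> -` D) \<partial>P)"
    proof (rule nn_integral_diff[symmetric])
      \<comment> \<open>Finiteness, needed to subtract in \<open>ennreal\<close>, comes from the
        induction hypothesis: the integral is a probability.\<close>
      show "(\<integral>\<^sup>+\<omega>. emeasure (K \<omega>) (Pair \<omega> -` D) \<partial>P) \<noteq> \<infinity>"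
        unfolding compl(2)[symmetric] by simp
      show "AE \<omega> in P. emeasure (K \<omega>) (Pair \<omega> -` D) \<le> 1"
        using prob_space.emeasure_le_1[OF K_prob] by auto
    qed (use slice_meas[OF D] in auto)
    also have "\<dots> = (\<integral>\<^sup>+\<omega>. emeasure (K \<omega>) (Pair \<omega> -` (space F \<times> space N - D)) \<partial>P)"
    proof (rule nn_integral_cong)
      fix \<omega> assume \<omega>: "\<omega> \<in> space P"
      then interpret K: prob_space "K \<omega>" by (rule K_prob)
      have sp: "space (K \<omega>) = space N" using K_sets[OF \<omega>] by (rule sets_eq_imp_space_eq)
      have "Pair \<omega> -` (space F \<times> space N - D) = space (K \<omega>) - Pair \<omega> -` D"
        using \<omega> by (auto simp: space_F sp)
      moreover have "Pair \<omega> -` D \<in> sets (K \<omega>)"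
        using sets_Pair1[OF D, of \<omega>] by (simp add: K_sets[OF \<omega>])
      ultimately show "1 - emeasure (K \<omega>) (Pair \<omega> -` D) = emeasure (K \<omega>) (Pair \<omega> -` (space F \<times> space N - D))"
        by (simp add: emeasure_compl K.emeasure_space_1)
    qed
    finally show ?case .
  next
    case (union D)
    have D [measurable]: "D i \<in> sets (F \<Otimes>\<^sub>M N)" for i using union by (auto simp: sets_FN)
    have disj: "disjoint_family (\<lambda>i. Pair \<omega> -` D i)" "disjoint_family (\<lambda>i. {\<omega> \<in> space P. (\<omega>, L \<omega>) \<in> D i})" for \<omega>
      using union(1) by (auto simp: disjoint_family_on_def)
    have "emeasure P {\<omega> \<in> space P. (\<omega>, L \<omega>) \<in> (\<Union>i. D i)} = emeasure P (\<Union>i. {\<omega> \<in> space P. (\<omega>, L \<omega>) \<in> D i})"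
      by (intro arg_cong[where f = "emeasure P"]) auto
    also have "\<dots> = (\<Sum>i. emeasure P {\<omega> \<in> space P. (\<omega>, L \<omega>) \<in> D i})"
      using disj(2) joint[OF D] by (intro suminf_emeasure[symmetric]) auto
    also have "\<dots> = (\<Sum>i. \<integral>\<^sup>+\<omega>. emeasure (K \<omega>) (Pair \<omega> -` D i) \<partial>P)"
      by (simp add: union)
    also have "\<dots> = (\<integral>\<^sup>+\<omega>. (\<Sum>i. emeasure (K \<omega>) (Pair \<omega> -` D i)) \<partial>P)"
      by (rule nn_integral_suminf[symmetric]) (rule slice_meas[OF D])
    also have "\<dots> = (\<integral>\<^sup>+\<omega>. emeasure (K \<omega>) (Pair \<omega> -` (\<Union>i. D i)) \<partial>P)"
    proof (rule nn_integral_cong)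
      fix \<omega> assume \<omega>: "\<omega> \<in> space P"
      have "range (\<lambda>i. Pair \<omega> -` D i) \<subseteq> sets (K \<omega>)"
        using sets_Pair1[OF D, of \<omega>] by (auto simp: K_sets[OF \<omega>])
      then show "(\<Sum>i. emeasure (K \<omega>) (Pair \<omega> -` D i)) = emeasure (K \<omega>) (Pair \<omega> -` (\<Union>i. D i))"
        using disj(1) by (subst suminf_emeasure) (auto simp: vimage_UN)
    qed
    finally show ?case .
  qed
qed

text \<open>The last clause is the change-of-measure formula for the law of
  \<open>(\<omega>, L \<omega>)\<close>. Positivity along \<open>L\<close> records that a density is
  positive almost everywhere under the measure it defines; it makes \<open>1 / q\<close>
  usable.\<close>

definition joint_density ::
  "'a measure \<Rightarrow> 'a measure \<Rightarrow> ('a \<Rightarrow> 'l) \<Rightarrow> 'l measure \<Rightarrow> ('a \<times> 'l \<Rightarrow> real) \<Rightarrow> bool" where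
  "joint_density P F L N q \<longleftrightarrow> q \<in> borel_measurable (F \<Otimes>\<^sub>M N) \<and> (\<forall>x. 0 \<le> q x) \<and>
     (AE \<omega> in P. 0 < q (\<omega>, L \<omega>)) \<and>
     (\<forall>f \<in> borel_measurable (F \<Otimes>\<^sub>M N).
        (\<integral>\<^sup>+\<omega>. f (\<omega>, L \<omega>) \<partial>P) = (\<integral>\<^sup>+\<omega>. \<integral>\<^sup>+l. ennreal (q (\<omega>, l)) * f (\<omega>, l) \<partial>distr P N L \<partial>P))"

text \<open>
  Applying Radon--Nikodym on the product space, rather than to each \<open>K \<omega>\<close>, makes the density jointly
  measurable.
\<close>

lemma ex_joint_density:
  assumes "prob_space P" and F: "subalgebra P F" and L [measurable]: "L \<in> P \<rightarrow>\<^sub>M N"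
    and K: "regular_conditional_distribution P F L N K"
    and ac: "AE \<omega> in P. absolutely_continuous (distr P N L) (K \<omega>)"
  shows "\<exists>q. joint_density P F L N q"
proof -
  interpret prob_space P by fact
  \<comment> \<open>Restricting \<open>P\<close> to \<open>F\<close> first makes the Radon-Nikodym
    derivative measurable with respect to \<open>F\<close>, not merely \<open>P\<close>.\<close>
  define R where "R = restr_to_subalg P F"
  define \<eta> where "\<eta> = distr P N L"
  define S where "S = R \<Otimes>\<^sub>M \<eta>"
  define Q where "Q = distr P (F \<Otimes>\<^sub>M N) (\<lambda>\<omega>. (\<omega>, L \<omega>))"
  interpret R: prob_space R
    unfolding R_def by (rule prob_space_restr_to_subalg[OF F]) fact
  interpret \<eta>: prob_space \<eta>
    unfolding \<eta>_def by (rule prob_space_distr) fact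
  interpret S: pair_prob_space R \<eta> ..
  interpret SS: prob_space S
    unfolding S_def by unfold_locales
  have sets_R: "sets R = sets F" by (simp add: R_def sets_restr_to_subalg[OF F])
  have sets_S: "sets S = sets (F \<Otimes>\<^sub>M N)"
    unfolding S_def by (rule sets_pair_measure_cong) (simp_all add: sets_R \<eta>_def)
  have pairs: "(\<lambda>\<omega>. (\<omega>, L \<omega>)) \<in> P \<rightarrow>\<^sub>M F \<Otimes>\<^sub>M N"
    using measurable_from_subalg[OF F, of "\<lambda>\<omega>. \<omega>" F] by (intro measurable_Pair) (auto simp: L)
  interpret Q: prob_space Q
    unfolding Q_def by (rule prob_space_distr[OF pairs])
  have sets_Q: "sets Q = sets S" by (simp add: Q_def sets_S)
  \<comment> \<open>Almost every slice of a product null set is null for the law of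
    \<open>L\<close>, hence by Jacod's criterion for \<open>K \<omega>\<close>; integrating the
    slices gives the joint law.\<close>
  have Q_ac: "absolutely_continuous S Q"
    unfolding absolutely_continuous_def
  proof
    fix D assume D: "D \<in> null_sets S"
    then have D_sets: "D \<in> sets (F \<Otimes>\<^sub>M N)" "D \<in> sets (R \<Otimes>\<^sub>M \<eta>)"
      using sets_S by (auto simp: S_def)
    have "(\<integral>\<^sup>+\<omega>. emeasure \<eta> (Pair \<omega> -` D) \<partial>R) = 0"
      using D \<eta>.emeasure_pair_measure_alt[OF D_sets(2)] by (auto simp: S_def)
    then have "AE \<omega> in R. emeasure \<eta> (Pair \<omega> -` D) = 0"
      by (subst (asm) nn_integral_0_iff_AE) (auto intro: \<eta>.measurable_emeasure_Pair D_sets)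
    then have "AE \<omega> in P. emeasure \<eta> (Pair \<omega> -` D) = 0"
      unfolding R_def by (rule AE_restr_to_subalg[OF F])
    then have "AE \<omega> in P. emeasure (K \<omega>) (Pair \<omega> -` D) = 0"
      using ac
    proof eventually_elim
      case (elim \<omega>)
      have "Pair \<omega> -` D \<in> sets \<eta>" using sets_Pair1[OF D_sets(2)] .
      with elim show ?case
        by (auto simp: absolutely_continuous_def \<eta>_def null_sets_def)
    qed
    then have "(\<integral>\<^sup>+\<omega>. emeasure (K \<omega>) (Pair \<omega> -` D) \<partial>P) = (\<integral>\<^sup>+\<omega>. 0 \<partial>P)"
      by (rule nn_integral_cong_AE)
    then have "emeasure P {\<omega> \<in> space P. (\<omega>, L \<omega>) \<in> D} = 0"
      using emeasure_joint_law[OF assms(1) F L K D_sets(1)] by simp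
    then have "emeasure Q D = 0"
      unfolding Q_def by (subst emeasure_distr[OF pairs D_sets(1)]) (simp add: vimage_def Int_def conj_commute)
    then show "D \<in> null_sets Q"
      using D_sets(1) by (simp add: null_sets_def sets_Q sets_S)
  qed
  obtain q where q: "q \<in> borel_measurable S" "AE x in S. RN_deriv S Q x = ennreal (q x)"
    "AE x in Q. 0 < q x" "\<And>x. 0 \<le> q x"
    using SS.real_RN_deriv[OF Q.finite_measure_axioms Q_ac sets_Q] by metis
  have qF [measurable]: "q \<in> borel_measurable (F \<Otimes>\<^sub>M N)"
    using q(1) measurable_cong_sets[OF sets_S refl] by blast
  have "density S (\<lambda>x. ennreal (q x)) = density S (RN_deriv S Q)"
    using q by (intro density_cong) (auto elim!: eventually_mono)
  also have "\<dots> = Q" by (rule SS.density_RN_deriv[OF Q_ac sets_Q])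
  finally have dens: "density S (\<lambda>x. ennreal (q x)) = Q" .
  have "AE \<omega> in P. 0 < q (\<omega>, L \<omega>)"
    using q(3) unfolding Q_def by (subst (asm) AE_distr_iff[OF pairs]) auto
  moreover have "(\<integral>\<^sup>+\<omega>. f (\<omega>, L \<omega>) \<partial>P) = (\<integral>\<^sup>+\<omega>. \<integral>\<^sup>+l. ennreal (q (\<omega>, l)) * f (\<omega>, l) \<partial>\<eta> \<partial>P)"
    if f: "f \<in> borel_measurable (F \<Otimes>\<^sub>M N)" for f
  proof -
    have fS: "f \<in> borel_measurable S" using f measurable_cong_sets[OF sets_S refl] by blast
    have g: "(\<lambda>x. ennreal (q x) * f x) \<in> borel_measurable (R \<Otimes>\<^sub>M \<eta>)"
      using q(1) fS unfolding S_def by measurable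
    have g': "(\<lambda>x. ennreal (q x) * f x) \<in> borel_measurable (F \<Otimes>\<^sub>M \<eta>)"
      using g measurable_cong_sets[OF sets_pair_measure_cong[OF sets_R refl] refl] by blast
    have "(\<integral>\<^sup>+\<omega>. f (\<omega>, L \<omega>) \<partial>P) = (\<integral>\<^sup>+x. f x \<partial>Q)"
      unfolding Q_def by (rule nn_integral_distr[symmetric, OF pairs]) (use f in simp)
    also have "\<dots> = (\<integral>\<^sup>+x. ennreal (q x) * f x \<partial>S)"
      unfolding dens[symmetric] using q(1) fS by (intro nn_integral_density) auto
    also have "\<dots> = (\<integral>\<^sup>+\<omega>. \<integral>\<^sup>+l. ennreal (q (\<omega>, l)) * f (\<omega>, l) \<partial>\<eta> \<partial>R)"
      unfolding S_def by (rule \<eta>.nn_integral_fst[symmetric, OF g])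
    \<comment> \<open>The inner integral is \<open>F\<close>-measurable, so \<open>R\<close> may be
      replaced by \<open>P\<close>.\<close>
    also have "\<dots> = (\<integral>\<^sup>+\<omega>. \<integral>\<^sup>+l. ennreal (q (\<omega>, l)) * f (\<omega>, l) \<partial>\<eta> \<partial>P)"
      unfolding R_def
      by (rule nn_integral_subalgebra2[OF F \<eta>.borel_measurable_nn_integral_fst[OF g']])
    finally show ?thesis .
  qed
  ultimately show ?thesis
    using qF q(4) unfolding joint_density_def \<eta>_def by blast
qed

section \<open>The enlargement before taking right limits\<close>

text \<open>This is the sigma-algebra generated by \<open>F t\<close> and \<open>L\<close>. As a
  preimage under the graph map, each of its sets comes from one product-measurable \<open>D\<close>,
  so no induction over generators is needed later.\<close>

definition enlargement :: "'a measure \<Rightarrow> (real \<Rightarrow> 'a measure) \<Rightarrow> ('a \<Rightarrow> 'l) \<Rightarrow> 'l measure \<Rightarrow> real \<Rightarrow> 'a measure" where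
  "enlargement P F L N t = vimage_algebra (space P) (\<lambda>\<omega>. (\<omega>, L \<omega>)) (F t \<Otimes>\<^sub>M N)"

lemma sets_enlargement:
  assumes F: "subalgebra P (F t)" and L: "L \<in> P \<rightarrow>\<^sub>M N"
  shows "sets (enlargement P F L N t) = {{\<omega> \<in> space P. (\<omega>, L \<omega>) \<in> D} | D. D \<in> sets (F t \<Otimes>\<^sub>M N)}"
proof -
  have "(\<lambda>\<omega>. (\<omega>, L \<omega>)) \<in> space P \<rightarrow> space (F t \<Otimes>\<^sub>M N)"
    using F measurable_space[OF L] by (auto simp: subalgebra_def space_pair_measure)
  then show ?thesis
    by (simp add: enlargement_def sets_vimage_algebra2 vimage_def Int_def conj_commute)
qed

lemma measurable_enlargement:
  assumes F: "subalgebra P (F t)" and L: "L \<in> P \<rightarrow>\<^sub>M N"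
    and f: "f \<in> borel_measurable (F t \<Otimes>\<^sub>M N)"
  shows "(\<lambda>\<omega>. f (\<omega>, L \<omega>)) \<in> borel_measurable (enlargement P F L N t)"
proof (rule measurable_compose[OF _ f])
  have "(\<lambda>\<omega>. (\<omega>, L \<omega>)) \<in> space P \<rightarrow> space (F t \<Otimes>\<^sub>M N)"
    using F measurable_space[OF L] by (auto simp: subalgebra_def space_pair_measure)
  then show "(\<lambda>\<omega>. (\<omega>, L \<omega>)) \<in> enlargement P F L N t \<rightarrow>\<^sub>M F t \<Otimes>\<^sub>M N"
    unfolding enlargement_def by (rule measurable_vimage_algebra1)
qed

lemma sets_enlargement_eq_sigma_sets:
  assumes F: "subalgebra P (F t)" and L: "L \<in> P \<rightarrow>\<^sub>M N"
  shows "sets (enlargement P F L N t)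
    = sigma_sets (space P) (sets (F t) \<union> sets (vimage_algebra (space P) L N))" (is "_ = sigma_sets _ ?G")
proof
  have sp: "space (F t) = space P" using F by (simp add: subalgebra_def)
  have LN: "L \<in> space P \<rightarrow> space N" using measurable_space[OF L] by auto
  have G: "?G \<subseteq> Pow (space P)"
    using sets.space_closed[of "F t"] sets.space_closed[of "vimage_algebra (space P) L N"] by (auto simp: sp)
  let ?S = "sigma (space P) ?G"
  have sets_S: "sets ?S = sigma_sets (space P) ?G" using G by simp
  have "(\<lambda>\<omega>. \<omega>) \<in> ?S \<rightarrow>\<^sub>M F t"
    using G sp sets.sets_into_space[of _ "F t"]
    by (intro measurableI) (auto simp: sets_S space_measure_of_conv Int_absorb2)
  moreover have "L \<in> ?S \<rightarrow>\<^sub>M N"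
  proof (rule measurableI)
    fix B assume "B \<in> sets N"
    then have "L -` B \<inter> space P \<in> ?G" using LN by (auto simp: sets_vimage_algebra2)
    then show "L -` B \<inter> space ?S \<in> sets ?S"
      unfolding sets_S by (simp add: space_measure_of_conv sigma_sets.Basic)
  qed (use LN in \<open>auto simp: space_measure_of_conv\<close>)
  ultimately have "(\<lambda>\<omega>. (\<omega>, L \<omega>)) \<in> ?S \<rightarrow>\<^sub>M F t \<Otimes>\<^sub>M N" by (rule measurable_Pair)
  then have "{\<omega> \<in> space P. (\<omega>, L \<omega>) \<in> D} \<in> sets ?S" if "D \<in> sets (F t \<Otimes>\<^sub>M N)" for D
    using measurable_sets[OF _ that, of "\<lambda>\<omega>. (\<omega>, L \<omega>)" ?S]
    by (simp add: vimage_def Int_def conj_commute space_measure_of_conv)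
  then show "sets (enlargement P F L N t) \<subseteq> sigma_sets (space P) ?G"
    unfolding sets_enlargement[of P F t, OF F L] sets_S by blast
  have "?G \<subseteq> sets (enlargement P F L N t)"
  proof
    fix A assume "A \<in> ?G"
    then show "A \<in> sets (enlargement P F L N t)"
    proof
      assume A: "A \<in> sets (F t)"
      have "A = {\<omega> \<in> space P. (\<omega>, L \<omega>) \<in> A \<times> space N}"
        using sets.sets_into_space[OF A] LN by (auto simp: sp)
      moreover have "A \<times> space N \<in> sets (F t \<Otimes>\<^sub>M N)" using A by auto
      ultimately show ?thesis unfolding sets_enlargement[of P F t, OF F L] by blast
    next
      assume "A \<in> sets (vimage_algebra (space P) L N)"
      then obtain B where B: "B \<in> sets N" "A = L -` B \<inter> space P"
        using LN by (auto simp: sets_vimage_algebra2)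
      then have "A = {\<omega> \<in> space P. (\<omega>, L \<omega>) \<in> space (F t) \<times> B}" by (auto simp: sp)
      moreover have "space (F t) \<times> B \<in> sets (F t \<Otimes>\<^sub>M N)" using B by auto
      ultimately show ?thesis unfolding sets_enlargement[of P F t, OF F L] by blast
    qed
  qed
  then show "sigma_sets (space P) ?G \<subseteq> sets (enlargement P F L N t)"
    using sets.sigma_sets_subset[of ?G "enlargement P F L N t"] by (simp add: enlargement_def)
qed

lemma space_enlargement [simp]: "space (enlargement P F L N t) = space P"
  by (simp add: enlargement_def)

lemma enlargement_filtration:
  assumes F: "filtration_on P F" and L: "L \<in> P \<rightarrow>\<^sub>M N"
  shows "filtration_on P (enlargement P F L N)"
    and "0 \<le> t \<Longrightarrow> subalgebra (enlargement P F L N t) (F t)"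
proof -
  have sub: "subalgebra P (F t)" if "0 \<le> t" for t using F that by (simp add: filtration_on_def)
  have V: "sets (vimage_algebra (space P) L N) \<subseteq> sets P"
    using L by (auto simp: sets_vimage_algebra2 measurable_space measurable_sets)
  note eq = sets_enlargement_eq_sigma_sets[of P F, OF sub L]
  have "subalgebra P (enlargement P F L N t)" if t: "0 \<le> t" for t
    unfolding subalgebra_def eq[OF t] using sub[OF t] V
    by (intro conjI sets.sigma_sets_subset) (auto simp: subalgebra_def)
  moreover have "subalgebra (enlargement P F L N t) (enlargement P F L N s)" if "0 \<le> s" "s \<le> t" for s t
  proof -
    have "sets (F s) \<subseteq> sets (F t)" using F that by (auto simp: filtration_on_def subalgebra_def)
    then show ?thesis
      using that eq[of s] eq[of t] by (auto simp: subalgebra_def intro!: sigma_sets_mono)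
  qed
  ultimately show "filtration_on P (enlargement P F L N)" by (simp add: filtration_on_def)
  show "subalgebra (enlargement P F L N t) (F t)" if t: "0 \<le> t"
    using sub[OF t] eq[OF t] by (auto simp: subalgebra_def)
qed

lemma sets_initial_enlargement_eq:
  assumes F: "filtration_on P F" and L: "L \<in> P \<rightarrow>\<^sub>M N" and t: "0 \<le> t"
  shows "sets (initial_enlargement P F L N t) = (\<Inter>s\<in>{t<..}. sets (enlargement P F L N s))"
  unfolding sets_initial_enlargement[OF F t]
  using F t by (intro INF_cong refl sets_enlargement_eq_sigma_sets[symmetric] L) (auto simp: filtration_on_def)

text \<open>
  Cutting off \<open>q\<^sub>s = 0\<close>, which is a null event for \<open>(\<omega>, L \<omega>)\<close>, before passing to the product measure
  makes the supports of \<open>q\<^sub>t\<close> and \<open>q\<^sub>s\<close> comparable; afterwards Fubini reduces the claim to the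
  supermartingale property of \<open>M\<close> for each fixed value of \<open>L\<close>.
\<close>

lemma setwise_supermartingale_inverse_density:
  assumes "prob_space P" and F: "filtration_on P F" and L: "L \<in> P \<rightarrow>\<^sub>M N"
    and q: "\<And>t. 0 \<le> t \<Longrightarrow> joint_density P (F t) L N (q t)"
    and M: "setwise_supermartingale P F M"
  shows "setwise_supermartingale P (enlargement P F L N) (\<lambda>t \<omega>. inverse (q t (\<omega>, L \<omega>)) * M t \<omega>)"
    and "0 \<le> t \<Longrightarrow> (\<integral>\<^sup>+\<omega>. ennreal (inverse (q t (\<omega>, L \<omega>)) * M t \<omega>) \<partial>P) \<le> (\<integral>\<^sup>+\<omega>. ennreal (M t \<omega>) \<partial>P)"
proof -
  interpret prob_space P by fact
  define \<eta> where "\<eta> = distr P N L"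
  interpret \<eta>: prob_space \<eta> unfolding \<eta>_def by (rule prob_space_distr[OF L])
  interpret pair_prob_space P \<eta> ..
  have sub: "subalgebra P (F t)" if "0 \<le> t" for t using F that by (simp add: filtration_on_def)
  have subF: "subalgebra (F t) (F s)" if "0 \<le> s" "s \<le> t" for s t using F that by (simp add: filtration_on_def)
  have qm: "q t \<in> borel_measurable (F t \<Otimes>\<^sub>M N)" and q0: "0 \<le> q t x" and qpos: "AE \<omega> in P. 0 < q t (\<omega>, L \<omega>)"
    and qint: "f \<in> borel_measurable (F t \<Otimes>\<^sub>M N) \<Longrightarrow>
      (\<integral>\<^sup>+\<omega>. f (\<omega>, L \<omega>) \<partial>P) = (\<integral>\<^sup>+\<omega>. \<integral>\<^sup>+l. ennreal (q t (\<omega>, l)) * f (\<omega>, l) \<partial>\<eta> \<partial>P)"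
    if "0 \<le> t" for t x f
    using q[OF that] unfolding joint_density_def \<eta>_def by blast+
  have Mm: "M t \<in> borel_measurable (F t)" if "0 \<le> t" for t
    using M that by (auto simp: setwise_supermartingale_def adapted_def)
  \<comment> \<open>\<open>q t\<close> cancels against its inverse where it is positive; elsewhere
    the convention \<open>inverse 0 = 0\<close> gives 0. Both cases are recorded by the indicator of
    \<open>q t > 0\<close>.\<close>
  have key: "(\<integral>\<^sup>+\<omega>. ennreal (inverse (q t (\<omega>, L \<omega>)) * M t \<omega>) * indicator E (\<omega>, L \<omega>) \<partial>P)
      = (\<integral>\<^sup>+\<omega>. \<integral>\<^sup>+l. ennreal (M t \<omega>) * indicator E (\<omega>, l) * indicator {0<..} (q t (\<omega>, l)) \<partial>\<eta> \<partial>P)"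
    if t: "0 \<le> t" and E: "E \<in> sets (F t \<Otimes>\<^sub>M N)" for t E
  proof -
    let ?f = "\<lambda>x. ennreal (inverse (q t x) * M t (fst x)) * indicator E x"
    have [measurable]: "q t \<in> borel_measurable (F t \<Otimes>\<^sub>M N)" "M t \<in> borel_measurable (F t)"
      "E \<in> sets (F t \<Otimes>\<^sub>M N)"
      using qm Mm t E by auto
    have "(\<integral>\<^sup>+\<omega>. ?f (\<omega>, L \<omega>) \<partial>P) = (\<integral>\<^sup>+\<omega>. \<integral>\<^sup>+l. ennreal (q t (\<omega>, l)) * ?f (\<omega>, l) \<partial>\<eta> \<partial>P)"
      by (rule qint[OF t]) measurable
    also have "\<dots> = (\<integral>\<^sup>+\<omega>. \<integral>\<^sup>+l. ennreal (M t \<omega>) * indicator E (\<omega>, l) * indicator {0<..} (q t (\<omega>, l)) \<partial>\<eta> \<partial>P)"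
    proof (intro nn_integral_cong)
      fix \<omega> l
      have "ennreal (q t (\<omega>, l)) * ennreal (inverse (q t (\<omega>, l)) * M t \<omega>)
          = ennreal (M t \<omega>) * indicator {0<..} (q t (\<omega>, l))"
        using q0[OF t, of "(\<omega>, l)"]
        by (cases "q t (\<omega>, l) = 0") (auto simp: indicator_def simp flip: ennreal_mult' mult.assoc)
      then show "ennreal (q t (\<omega>, l)) * ?f (\<omega>, l)
          = ennreal (M t \<omega>) * indicator E (\<omega>, l) * indicator {0<..} (q t (\<omega>, l))"
        by (simp add: mult.assoc[symmetric]) (simp add: mult_ac)
    qed
    finally show ?thesis by simp
  qed
  show "setwise_supermartingale P (enlargement P F L N) (\<lambda>t \<omega>. inverse (q t (\<omega>, L \<omega>)) * M t \<omega>)"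
    unfolding setwise_supermartingale_def
  proof (intro conjI allI impI)
    show "adapted (enlargement P F L N) (\<lambda>t \<omega>. inverse (q t (\<omega>, L \<omega>)) * M t \<omega>)"
      unfolding adapted_def
    proof (intro allI impI)
      fix t :: real assume t: "0 \<le> t"
      have [measurable]: "(\<lambda>\<omega>. q t (\<omega>, L \<omega>)) \<in> borel_measurable (enlargement P F L N t)"
        by (rule measurable_enlargement[where F = F, OF sub[OF t] L qm[OF t]])
      have [measurable]: "M t \<in> borel_measurable (enlargement P F L N t)"
        by (rule measurable_from_subalg[OF enlargement_filtration(2)[OF F L t] Mm[OF t]])
      show "(\<lambda>\<omega>. inverse (q t (\<omega>, L \<omega>)) * M t \<omega>) \<in> borel_measurable (enlargement P F L N t)"
        by measurable
    qed
  next
    fix s t C assume st: "0 \<le> s" "s \<le> t" and C: "C \<in> sets (enlargement P F L N s)"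
    then have t: "0 \<le> t" by simp
    obtain D where D: "D \<in> sets (F s \<Otimes>\<^sub>M N)" and C_eq: "C = {\<omega> \<in> space P. (\<omega>, L \<omega>) \<in> D}"
      using C unfolding sets_enlargement[of P F s, OF sub[OF st(1)] L] by blast
    define E where "E = {x \<in> space (F s \<Otimes>\<^sub>M N). x \<in> D \<and> 0 < q s x}"
    have [measurable]: "q s \<in> borel_measurable (F s \<Otimes>\<^sub>M N)" by (rule qm[OF st(1)])
    have E: "E \<in> sets (F s \<Otimes>\<^sub>M N)" unfolding E_def using D by measurable
    have Et: "E \<in> sets (F t \<Otimes>\<^sub>M N)"
      using subalgebra_pair_measure[OF subF[OF st], of N] E by (auto simp: subalgebra_def)
    have EP: "E \<in> sets (P \<Otimes>\<^sub>M \<eta>)"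
      using subalgebra_pair_measure[OF sub[OF st(1)], of N] E
      by (auto simp: subalgebra_def \<eta>_def cong: sets_pair_measure_cong)
    have C_E: "AE \<omega> in P. indicator C \<omega> = (indicator E (\<omega>, L \<omega>) :: ennreal)"
      using qpos[OF st(1)] AE_space
      by eventually_elim
        (use measurable_space[OF L] sub[OF st(1)] in
          \<open>auto simp: C_eq E_def indicator_def space_pair_measure subalgebra_def\<close>)
    have slice: "{\<omega> \<in> space P. (\<omega>, l) \<in> E} \<in> sets (F s)" for l
    proof -
      have "{\<omega> \<in> space P. (\<omega>, l) \<in> E} = (\<lambda>\<omega>. (\<omega>, l)) -` E"
        using sub[OF st(1)] by (auto simp: E_def space_pair_measure subalgebra_def)
      then show ?thesis using sets_Pair2[OF E, of l] by simp
    qed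
    have PM: "M u \<in> borel_measurable P" if "0 \<le> u" for u
      by (rule measurable_from_subalg[OF sub[OF that] Mm[OF that]])
    have swap: "(\<integral>\<^sup>+\<omega>. \<integral>\<^sup>+l. ennreal (M u \<omega>) * indicator E (\<omega>, l) \<partial>\<eta> \<partial>P)
        = (\<integral>\<^sup>+l. \<integral>\<^sup>+\<omega>. ennreal (M u \<omega>) * indicator E (\<omega>, l) \<partial>P \<partial>\<eta>)" if "0 \<le> u" for u
    proof (rule Fubini'[symmetric])
      have [measurable]: "M u \<in> borel_measurable P" "E \<in> sets (P \<Otimes>\<^sub>M \<eta>)" using PM[OF that] EP by auto
      show "(\<lambda>(\<omega>, l). ennreal (M u \<omega>) * indicator E (\<omega>, l)) \<in> borel_measurable (P \<Otimes>\<^sub>M \<eta>)"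
        by measurable
    qed
    have "(\<integral>\<^sup>+\<omega>. ennreal (inverse (q t (\<omega>, L \<omega>)) * M t \<omega>) * indicator C \<omega> \<partial>P)
        = (\<integral>\<^sup>+\<omega>. ennreal (inverse (q t (\<omega>, L \<omega>)) * M t \<omega>) * indicator E (\<omega>, L \<omega>) \<partial>P)"
      by (rule nn_integral_cong_AE) (use C_E in \<open>eventually_elim, simp\<close>)
    also have "\<dots> = (\<integral>\<^sup>+\<omega>. \<integral>\<^sup>+l. ennreal (M t \<omega>) * indicator E (\<omega>, l) * indicator {0<..} (q t (\<omega>, l)) \<partial>\<eta> \<partial>P)"
      by (rule key[OF t Et])
    \<comment> \<open>Dropping the cut-off \<open>q t > 0\<close> may enlarge the integral, so even
      a martingale \<open>M\<close> yields only an inequality.\<close>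
    also have "\<dots> \<le> (\<integral>\<^sup>+\<omega>. \<integral>\<^sup>+l. ennreal (M t \<omega>) * indicator E (\<omega>, l) \<partial>\<eta> \<partial>P)"
      by (intro nn_integral_mono) (auto simp: indicator_def)
    also have "\<dots> = (\<integral>\<^sup>+l. \<integral>\<^sup>+\<omega>. ennreal (M t \<omega>) * indicator E (\<omega>, l) \<partial>P \<partial>\<eta>)"
      by (rule swap[OF t])
    also have "\<dots> \<le> (\<integral>\<^sup>+l. \<integral>\<^sup>+\<omega>. ennreal (M s \<omega>) * indicator E (\<omega>, l) \<partial>P \<partial>\<eta>)"
    proof (rule nn_integral_mono)
      fix l
      have ind: "(\<integral>\<^sup>+\<omega>. ennreal (M u \<omega>) * indicator E (\<omega>, l) \<partial>P)
          = (\<integral>\<^sup>+\<omega>. ennreal (M u \<omega>) * indicator {\<omega> \<in> space P. (\<omega>, l) \<in> E} \<omega> \<partial>P)" for u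
        by (intro nn_integral_cong) (auto simp: indicator_def)
      show "(\<integral>\<^sup>+\<omega>. ennreal (M t \<omega>) * indicator E (\<omega>, l) \<partial>P) \<le> (\<integral>\<^sup>+\<omega>. ennreal (M s \<omega>) * indicator E (\<omega>, l) \<partial>P)"
        unfolding ind using M st slice[of l] by (simp add: setwise_supermartingale_def)
    qed
    also have "\<dots> = (\<integral>\<^sup>+\<omega>. \<integral>\<^sup>+l. ennreal (M s \<omega>) * indicator E (\<omega>, l) \<partial>\<eta> \<partial>P)"
      by (rule swap[OF st(1), symmetric])
    \<comment> \<open>\<open>E\<close> already lies in \<open>q s > 0\<close>, so restoring this
      cut-off is an equality and \<open>key\<close> applies at \<open>s\<close>.\<close>
    also have "\<dots> = (\<integral>\<^sup>+\<omega>. \<integral>\<^sup>+l. ennreal (M s \<omega>) * indicator E (\<omega>, l) * indicator {0<..} (q s (\<omega>, l)) \<partial>\<eta> \<partial>P)"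
      by (intro nn_integral_cong) (auto simp: indicator_def E_def)
    also have "\<dots> = (\<integral>\<^sup>+\<omega>. ennreal (inverse (q s (\<omega>, L \<omega>)) * M s \<omega>) * indicator E (\<omega>, L \<omega>) \<partial>P)"
      by (rule key[OF st(1) E, symmetric])
    also have "\<dots> = (\<integral>\<^sup>+\<omega>. ennreal (inverse (q s (\<omega>, L \<omega>)) * M s \<omega>) * indicator C \<omega> \<partial>P)"
      by (rule nn_integral_cong_AE) (use C_E in \<open>eventually_elim, simp\<close>)
    finally show "(\<integral>\<^sup>+\<omega>. ennreal (inverse (q t (\<omega>, L \<omega>)) * M t \<omega>) * indicator C \<omega> \<partial>P)
        \<le> (\<integral>\<^sup>+\<omega>. ennreal (inverse (q s (\<omega>, L \<omega>)) * M s \<omega>) * indicator C \<omega> \<partial>P)" .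
  qed
  show "(\<integral>\<^sup>+\<omega>. ennreal (inverse (q t (\<omega>, L \<omega>)) * M t \<omega>) \<partial>P) \<le> (\<integral>\<^sup>+\<omega>. ennreal (M t \<omega>) \<partial>P)"
    if t: "0 \<le> t" for t
  proof -
    have "(\<integral>\<^sup>+\<omega>. ennreal (inverse (q t (\<omega>, L \<omega>)) * M t \<omega>) \<partial>P)
        = (\<integral>\<^sup>+\<omega>. ennreal (inverse (q t (\<omega>, L \<omega>)) * M t \<omega>) * indicator (space (F t \<Otimes>\<^sub>M N)) (\<omega>, L \<omega>) \<partial>P)"
      using measurable_space[OF L] sub[OF t]
      by (intro nn_integral_cong) (auto simp: indicator_def space_pair_measure subalgebra_def)
    also have "\<dots> = (\<integral>\<^sup>+\<omega>. \<integral>\<^sup>+l. ennreal (M t \<omega>) * indicator (space (F t \<Otimes>\<^sub>M N)) (\<omega>, l)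
        * indicator {0<..} (q t (\<omega>, l)) \<partial>\<eta> \<partial>P)"
      by (rule key[OF t]) auto
    also have "\<dots> \<le> (\<integral>\<^sup>+\<omega>. \<integral>\<^sup>+l. ennreal (M t \<omega>) \<partial>\<eta> \<partial>P)"
      by (intro nn_integral_mono) (auto simp: indicator_def)
    also have "\<dots> = (\<integral>\<^sup>+\<omega>. ennreal (M t \<omega>) \<partial>P)"
      by (simp add: \<eta>.emeasure_space_1)
    finally show ?thesis .
  qed
qed

subsection \<open>Supermartingales and set integrals\<close>

lemma nn_integral_indicator_eq_set_integral:
  fixes h :: "'a \<Rightarrow> real"
  assumes "integrable M h" "AE x in M. 0 \<le> h x" "C \<in> sets M"
  shows "(\<integral>\<^sup>+x. ennreal (h x) * indicator C x \<partial>M) = ennreal (\<integral>x\<in>C. h x \<partial>M)"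
proof -
  have "(\<integral>\<^sup>+x. ennreal (h x) * indicator C x \<partial>M) = (\<integral>\<^sup>+x. ennreal (indicator C x *\<^sub>R h x) \<partial>M)"
    by (intro nn_integral_cong) (auto simp: indicator_def)
  also have "\<dots> = ennreal (\<integral>x\<in>C. h x \<partial>M)"
    unfolding set_lebesgue_integral_def
  proof (rule nn_integral_eq_integral)
    show "integrable M (\<lambda>x. indicator C x *\<^sub>R h x)"
      using assms by (intro integrable_mult_indicator)
    show "AE x in M. 0 \<le> indicator C x *\<^sub>R h x"
      using assms(2) by eventually_elim (auto simp: indicator_def)
  qed
  finally show ?thesis .
qed

lemma supermartingale_imp_setwise:
  assumes "prob_space P" and F: "filtration_on P F" and M: "supermartingale P F M"
    and nonneg: "\<And>t. 0 \<le> t \<Longrightarrow> AE \<omega> in P. 0 \<le> M t \<omega>"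
  shows "setwise_supermartingale P F M"
  unfolding setwise_supermartingale_def
proof (intro conjI allI impI)
  show "adapted F M" using M by (simp add: supermartingale_def)
next
  interpret prob_space P by fact
  fix s t C assume st: "0 \<le> s" "s \<le> t" and C: "C \<in> sets (F s)"
  then have t: "0 \<le> t" by simp
  interpret F: finite_measure_subalgebra P "F s"
    using F st by unfold_locales (simp add: filtration_on_def)
  have [measurable]: "C \<in> sets P" using C F.subalg by (auto simp: subalgebra_def)
  have int [simp]: "integrable P (M u)" if "0 \<le> u" for u using M that by (simp add: supermartingale_def)
  have nn: "(\<integral>\<^sup>+\<omega>. ennreal (M u \<omega>) * indicator C \<omega> \<partial>P) = ennreal (\<integral>\<omega>\<in>C. M u \<omega> \<partial>P)" if u: "0 \<le> u" for u
    by (rule nn_integral_indicator_eq_set_integral) (use u nonneg in auto)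
  have "(\<integral>\<omega>\<in>C. M t \<omega> \<partial>P) = (\<integral>\<omega>\<in>C. real_cond_exp P (F s) (M t) \<omega> \<partial>P)"
    using t C by (intro F.real_cond_exp_intA) auto
  also have "\<dots> \<le> (\<integral>\<omega>\<in>C. M s \<omega> \<partial>P)"
    unfolding set_lebesgue_integral_def
  proof (rule integral_mono_AE)
    have "AE \<omega> in P. real_cond_exp P (F s) (M t) \<omega> \<le> M s \<omega>"
      using M st by (auto simp: supermartingale_def)
    then show "AE \<omega> in P. indicator C \<omega> *\<^sub>R real_cond_exp P (F s) (M t) \<omega> \<le> indicator C \<omega> *\<^sub>R M s \<omega>"
      by eventually_elim (auto simp: indicator_def)
  qed (use t st in \<open>intro integrable_mult_indicator F.real_cond_exp_int int; simp\<close>)+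
  finally show "(\<integral>\<^sup>+\<omega>. ennreal (M t \<omega>) * indicator C \<omega> \<partial>P) \<le> (\<integral>\<^sup>+\<omega>. ennreal (M s \<omega>) * indicator C \<omega> \<partial>P)"
    unfolding nn[OF t] nn[OF st(1)] by (rule ennreal_leI)
qed

text \<open>Test on the set where the inequality fails: the difference is positive there but its
  integral is at most 0, so the set is null.\<close>

lemma (in finite_measure_subalgebra) real_cond_exp_leI:
  assumes f [measurable]: "integrable M f" and g: "integrable M g" "g \<in> borel_measurable F"
    and nonneg: "AE x in M. 0 \<le> f x" "AE x in M. 0 \<le> g x"
    and le: "\<And>C. C \<in> sets F \<Longrightarrow>
      (\<integral>\<^sup>+x. ennreal (f x) * indicator C x \<partial>M) \<le> (\<integral>\<^sup>+x. ennreal (g x) * indicator C x \<partial>M)"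
  shows "AE x in M. real_cond_exp M F f x \<le> g x"
proof -
  define C where "C = {x \<in> space F. g x < real_cond_exp M F f x}"
  have C: "C \<in> sets F" unfolding C_def using g(2) by measurable
  have [measurable]: "C \<in> sets M" using C subalg by (auto simp: subalgebra_def)
  have nn: "(\<integral>\<^sup>+x. ennreal (h x) * indicator C x \<partial>M) = ennreal (\<integral>x\<in>C. h x \<partial>M)"
    if "integrable M h" "AE x in M. 0 \<le> h x" for h
    by (rule nn_integral_indicator_eq_set_integral) (use that in auto)
  \<comment> \<open>Needed to read an inequality between \<open>ennreal\<close> values as one
    between reals.\<close>
  have g0: "0 \<le> (\<integral>x\<in>C. g x \<partial>M)"
    unfolding set_lebesgue_integral_def
    by (intro integral_nonneg_AE) (use nonneg(2) in \<open>eventually_elim, simp\<close>)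
  have int_c: "integrable M (real_cond_exp M F f)" by (rule real_cond_exp_int(1)[OF f])
  let ?h = "\<lambda>x. indicator C x *\<^sub>R (real_cond_exp M F f x - g x)"
  have int_h: "integrable M ?h"
    by (intro integrable_mult_indicator Bochner_Integration.integrable_diff int_c g) simp
  have h0: "0 \<le> ?h x" for x by (auto simp: indicator_def C_def)
  have "(\<integral>x\<in>C. f x \<partial>M) \<le> (\<integral>x\<in>C. g x \<partial>M)"
    using le[OF C] nn[OF f nonneg(1)] nn[OF g(1) nonneg(2)] g0 by (simp add: ennreal_le_iff)
  then have "(\<integral>x\<in>C. real_cond_exp M F f x \<partial>M) \<le> (\<integral>x\<in>C. g x \<partial>M)"
    using real_cond_exp_intA[OF f C] by simp
  moreover have "(\<integral>x. ?h x \<partial>M) = (\<integral>x\<in>C. real_cond_exp M F f x \<partial>M) - (\<integral>x\<in>C. g x \<partial>M)"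
    unfolding set_lebesgue_integral_def scaleR_diff_right
    by (intro Bochner_Integration.integral_diff integrable_mult_indicator int_c g) simp_all
  ultimately have "(\<integral>x. ?h x \<partial>M) = 0"
    using Bochner_Integration.integral_nonneg[of M ?h] h0 by simp
  then have "AE x in M. ?h x = 0"
    using integral_nonneg_eq_0_iff_AE[OF int_h] h0 by simp
  then show ?thesis
    using AE_space
  proof eventually_elim
    case (elim x)
    then show ?case
      using subalg by (cases "x \<in> C") (auto simp: C_def subalgebra_def not_less)
  qed
qed

lemma cadlag_mult:
  assumes "cadlag f" "cadlag g"
  shows "cadlag (\<lambda>t. f t * g t)"
  using assms unfolding cadlag_def by (auto intro: continuous_mult) (blast intro: tendsto_mult)

theorem proposition5p2:
  fixes P :: "'a measure" and F :: "real \<Rightarrow> 'a measure"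
    and X :: "'l topology" and L :: "'a \<Rightarrow> 'l"
    and K :: "real \<Rightarrow> 'a \<Rightarrow> 'l measure"
  assumes "prob_space P"
    and "filtration_on P F"
    and "right_continuous_filtration F"
    and "Lusin_space X"
    and "L \<in> P \<rightarrow>\<^sub>M borel_of X"
    and "\<And>t. 0 \<le> t \<Longrightarrow> regular_conditional_distribution P (F t) L (borel_of X) (K t)"
    and "Jacod_criterion P L (borel_of X) K"
  shows "\<exists>Z. universal_supermartingale_density P F (initial_enlargement P F L (borel_of X)) Z"
proof -
  interpret prob_space P by fact
  let ?N = "borel_of X"
  note F = assms(2) and L = assms(5)
  define J where "J = enlargement P F L ?N"
  define G where "G = initial_enlargement P F L ?N"
  have J: "filtration_on P J" unfolding J_def by (rule enlargement_filtration(1)[OF F L])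
  have G: "filtration_on P G"
    unfolding G_def by (rule initial_enlargement_filtration(1)[OF F L])
  have GF: "subalgebra (G t) (F t)" if "0 \<le> t" for t
    unfolding G_def by (rule initial_enlargement_filtration(2)[OF F L that])
  have sets_G: "sets (G t) = (\<Inter>s\<in>{t<..}. sets (J s))" if "0 \<le> t" for t
    unfolding G_def J_def by (rule sets_initial_enlargement_eq[OF F L that])
  \<comment> \<open>The zero function fills the negative times, so \<open>Y\<close> is nonnegative
    for all \<open>t\<close>, as \<open>AE_dyadic_regular\<close> demands.\<close>
  have "\<exists>q. (\<forall>x. 0 \<le> q x) \<and> (0 \<le> t \<longrightarrow> joint_density P (F t) L ?N q)" for t
  proof (cases "0 \<le> t")
    case True
    then have "\<exists>q. joint_density P (F t) L ?N q"
      using F assms(6)[OF True] assms(7)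
      by (intro ex_joint_density[OF assms(1) _ L]) (auto simp: filtration_on_def Jacod_criterion_def)
    then show ?thesis by (auto simp: joint_density_def)
  next
    case False
    then show ?thesis by (intro exI[of _ "\<lambda>_. 0"]) auto
  qed
  then obtain q where q0: "\<And>t x. 0 \<le> q t x" and q: "\<And>t. 0 \<le> t \<Longrightarrow> joint_density P (F t) L ?N (q t)"
    by metis
  define Y where "Y t \<omega> = inverse (q t (\<omega>, L \<omega>))" for t \<omega>
  define Z where "Z t \<omega> = right_limit (\<lambda>t. Y t \<omega>) t" for t \<omega>
  note product = setwise_supermartingale_inverse_density[OF assms(1) F L q, folded J_def]
  \<comment> \<open>The constant supermartingale 1 specialises the product result to
    \<open>Y\<close> itself and bounds the expectation of \<open>Y 0\<close> by 1.\<close>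
  have one: "setwise_supermartingale P F (\<lambda>_ _. 1)"
    by (simp add: setwise_supermartingale_def adapted_def)
  have Y: "setwise_supermartingale P J Y"
    using product(1)[OF _ one] by (simp add: Y_def[abs_def])
  have Y_nonneg: "0 \<le> Y t \<omega>" for t \<omega> by (simp add: Y_def q0)
  have "(\<integral>\<^sup>+\<omega>. ennreal (Y 0 \<omega>) \<partial>P) \<le> 1"
    using product(2)[OF _ one, of 0] by (simp add: Y_def emeasure_space_1)
  then have "(\<integral>\<^sup>+\<omega>. ennreal (Y 0 \<omega>) \<partial>P) < \<infinity>"
    by (rule le_less_trans) simp
  then have reg: "AE \<omega> in P. dyadic_regular (\<lambda>t. Y t \<omega>)"
    by (intro AE_dyadic_regular[OF assms(1) J Y Y_nonneg])
  have limY: "AE \<omega> in P. (\<lambda>n. Y (dyadic_above n t) \<omega>) \<longlonglongrightarrow> Z t \<omega>" if "0 \<le> t" for t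
    using reg unfolding Z_def by eventually_elim (rule tendsto_right_limit(2)[OF _ that])
  have Z_nonneg: "AE \<omega> in P. 0 \<le> Z t \<omega>" if "0 \<le> t" for t
    using limY[OF that] by eventually_elim (rule LIMSEQ_le_const, auto simp: Y_nonneg)
  have Z_adapted: "adapted G Z"
    unfolding adapted_def
  proof (intro allI impI)
    fix t :: real assume t: "0 \<le> t"
    have sp: "space (G t) = space (J s)" for s
      by (simp add: J_def G_def initial_enlargement_def space_measure_of_conv)
    \<comment> \<open>Measurability for every \<open>J s\<close> with \<open>s > t\<close> is
      measurability for \<open>G t\<close>, with no null set involved.\<close>
    have "Z t \<in> borel_measurable (J s)" if "t < s" for s
      unfolding Z_def using right_limit_measurable[OF J _ t that] Y
      by (auto simp: setwise_supermartingale_def)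
    then have "Z t -` A \<inter> space (G t) \<in> sets (J s)" if "t < s" "A \<in> sets borel" for s A
      unfolding sp[of s] using that by (blast intro: measurable_sets)
    then show "Z t \<in> borel_measurable (G t)"
      by (intro measurableI) (auto simp: sets_G[OF t])
  qed
  have Z_cadlag: "as_cadlag P Z"
    unfolding as_cadlag_def
    using reg
  proof eventually_elim
    case (elim \<omega>)
    then show ?case using cadlag_right_limit by (simp add: Z_def)
  qed
  have ZP: "Z t \<in> borel_measurable P" if t: "0 \<le> t" for t
    by (rule adapted_measurable[OF G Z_adapted t])
  have Z_pos: "AE \<omega> in P. 0 < Z t \<omega>" if t: "0 \<le> t" for t
  proof -
    \<comment> \<open>\<open>t + 1\<close> is just some later time; \<open>Y (t + 1)\<close> is
      almost surely positive because \<open>q (t + 1)\<close> is positive along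
      \<open>L\<close>.\<close>
    have t1: "0 \<le> t + 1" using t by simp
    define C where "C = {\<omega> \<in> space (G t). Z t \<omega> \<le> 0}"
    have "Z t \<in> borel_measurable (G t)" using Z_adapted t by (simp add: adapted_def)
    then have "C \<in> sets (G t)" unfolding C_def by measurable
    then have C: "C \<in> sets (J u)" if "t < u" for u using that by (auto simp: sets_G[OF t])
    have [measurable]: "C \<in> sets P"
      using \<open>C \<in> sets (G t)\<close> G t by (auto simp: filtration_on_def subalgebra_def)
    have [measurable]: "Y (t + 1) \<in> borel_measurable P"
      using adapted_measurable[OF J _ t1] Y by (auto simp: setwise_supermartingale_def)
    have "(\<integral>\<^sup>+\<omega>. ennreal (Y (t + 1) \<omega>) * indicator C \<omega> \<partial>P) \<le> (\<integral>\<^sup>+\<omega>. ennreal (Z t \<omega>) * indicator C \<omega> \<partial>P)"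
      by (rule nn_integral_le_right_limit[OF assms(1) J Y t _ C ZP[OF t] limY[OF t]]) auto
    also have "\<dots> = (\<integral>\<^sup>+\<omega>. 0 \<partial>P)"
      by (intro nn_integral_cong) (auto simp: C_def indicator_def ennreal_neg)
    finally have "AE \<omega> in P. ennreal (Y (t + 1) \<omega>) * indicator C \<omega> = 0"
      by (subst nn_integral_0_iff_AE[symmetric]) auto
    moreover have "AE \<omega> in P. 0 < q (t + 1) (\<omega>, L \<omega>)"
      using q[OF t1] by (simp add: joint_density_def)
    ultimately show ?thesis
      using AE_space
    proof eventually_elim
      case (elim \<omega>)
      then have "\<omega> \<notin> C" by (auto simp: Y_def indicator_def)
      then show ?case
        using elim(3) by (auto simp: C_def G_def initial_enlargement_def space_measure_of_conv)
    qed
  qed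
  have "supermartingale P G (\<lambda>t \<omega>. Z t \<omega> * M t \<omega>)"
    if M: "supermartingale P F M" and M0: "\<forall>t\<ge>0. AE \<omega> in P. 0 \<le> M t \<omega>" for M
  proof -
    have Mset: "setwise_supermartingale P F M"
      using M0 by (intro supermartingale_imp_setwise[OF assms(1) F M]) auto
    define W where "W t \<omega> = Y t \<omega> * M t \<omega>" for t \<omega>
    have W: "setwise_supermartingale P J W"
      using product(1)[OF _ Mset] by (simp add: W_def[abs_def] Y_def)
    have M_adapted: "adapted F M" and M_cadlag: "as_cadlag P M" and M_int: "integrable P (M 0)"
      using M by (auto simp: supermartingale_def)
    have adapted_ZM: "adapted G (\<lambda>t \<omega>. Z t \<omega> * M t \<omega>)"
      unfolding adapted_def
    proof (intro allI impI)
      fix t :: real assume t: "0 \<le> t"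
      have "M t \<in> borel_measurable (G t)"
        using M_adapted t by (intro measurable_from_subalg[OF GF[OF t]]) (simp add: adapted_def)
      then show "(\<lambda>\<omega>. Z t \<omega> * M t \<omega>) \<in> borel_measurable (G t)"
        using Z_adapted t by (intro borel_measurable_times) (auto simp: adapted_def)
    qed
    have ZM_nonneg: "AE \<omega> in P. 0 \<le> Z t \<omega> * M t \<omega>" if "0 \<le> t" for t
      using Z_nonneg[OF that] M0[rule_format, OF that] by eventually_elim simp
    \<comment> \<open>\<open>W\<close> needs no regularisation of its own: along the same times
      \<open>Y\<close> tends to \<open>Z t\<close>, and \<open>M\<close> to \<open>M t\<close> by
      right continuity.\<close>
    have limW: "AE \<omega> in P. (\<lambda>n. W (dyadic_above n t) \<omega>) \<longlonglongrightarrow> Z t \<omega> * M t \<omega>" if t: "0 \<le> t" for t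
      using limY[OF t] M_cadlag[unfolded as_cadlag_def]
    proof eventually_elim
      case (elim \<omega>)
      then have "((\<lambda>t. M t \<omega>) \<longlongrightarrow> M t \<omega>) (at_right t)"
        using t by (auto simp: cadlag_def continuous_within)
      then have "(\<lambda>n. M (dyadic_above n t) \<omega>) \<longlonglongrightarrow> M t \<omega>"
        by (rule filterlim_compose[OF _ filterlim_dyadic_above_at_right])
      with elim(1) show ?case unfolding W_def by (rule tendsto_mult)
    qed
    \<comment> \<open>The bound goes through time 0 and is uniform in \<open>t\<close>, so Fatou
      gives integrability of \<open>Z t * M t\<close>.\<close>
    have W_le: "(\<integral>\<^sup>+\<omega>. ennreal (W t \<omega>) \<partial>P) \<le> (\<integral>\<^sup>+\<omega>. ennreal (M 0 \<omega>) \<partial>P)" if t: "0 \<le> t" for t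
    proof -
      have "space P \<in> sets (J 0)" by (metis J_def sets.top space_enlargement)
      then have "(\<integral>\<^sup>+\<omega>. ennreal (W t \<omega>) * indicator (space P) \<omega> \<partial>P)
          \<le> (\<integral>\<^sup>+\<omega>. ennreal (W 0 \<omega>) * indicator (space P) \<omega> \<partial>P)"
        using W t unfolding setwise_supermartingale_def by blast
      moreover have "(\<integral>\<^sup>+\<omega>. f \<omega> * indicator (space P) \<omega> \<partial>P) = (\<integral>\<^sup>+\<omega>. f \<omega> \<partial>P)" for f :: "'a \<Rightarrow> ennreal"
        by (intro nn_integral_cong) (auto simp: indicator_def)
      ultimately show ?thesis
        using product(2)[OF _ Mset, of 0] by (simp add: W_def Y_def)
    qed
    have int: "integrable P (\<lambda>\<omega>. Z t \<omega> * M t \<omega>)" if t: "0 \<le> t" for t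
    proof (rule integrableI_nonneg[OF _ ZM_nonneg[OF t]])
      show "(\<lambda>\<omega>. Z t \<omega> * M t \<omega>) \<in> borel_measurable P"
        by (rule adapted_measurable[OF G adapted_ZM t])
      have above: "0 \<le> dyadic_above n t" for n using dyadic_above_greater[of t n] t by linarith
      have "(\<integral>\<^sup>+\<omega>. ennreal (Z t \<omega> * M t \<omega>) \<partial>P) \<le> (\<integral>\<^sup>+\<omega>. ennreal (M 0 \<omega>) \<partial>P)"
      proof (rule nn_integral_le_of_tendsto)
        show "(\<lambda>\<omega>. ennreal (W (dyadic_above n t) \<omega>)) \<in> borel_measurable P" for n
          using adapted_measurable[OF J _ above] W by (auto simp: setwise_supermartingale_def)
        show "AE \<omega> in P. (\<lambda>n. ennreal (W (dyadic_above n t) \<omega>)) \<longlonglongrightarrow> ennreal (Z t \<omega> * M t \<omega>)"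
          using limW[OF t] by eventually_elim (rule tendsto_ennrealI)
      qed (use W_le[OF above] in simp)
      also have "\<dots> < \<infinity>"
        using M_int M0 by (subst nn_integral_eq_integral) auto
      finally show "(\<integral>\<^sup>+\<omega>. ennreal (Z t \<omega> * M t \<omega>) \<partial>P) < \<infinity>" .
    qed
    show ?thesis
      unfolding supermartingale_def
    proof (intro conjI allI impI)
      show "as_cadlag P (\<lambda>t \<omega>. Z t \<omega> * M t \<omega>)"
        using Z_cadlag M_cadlag unfolding as_cadlag_def by eventually_elim (rule cadlag_mult)
    next
      fix s t :: real assume st: "0 \<le> s" "s \<le> t"
      then have t: "0 \<le> t" by simp
      interpret finite_measure_subalgebra P "G s"
        using G st by unfold_locales (simp add: filtration_on_def)
      show "AE \<omega> in P. real_cond_exp P (G s) (\<lambda>\<omega>. Z t \<omega> * M t \<omega>) \<omega> \<le> Z s \<omega> * M s \<omega>"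
      proof (rule real_cond_exp_leI[OF int[OF t] int[OF st(1)] _ ZM_nonneg[OF t] ZM_nonneg[OF st(1)]])
        show "(\<lambda>\<omega>. Z s \<omega> * M s \<omega>) \<in> borel_measurable (G s)"
          using adapted_ZM st by (simp add: adapted_def)
        fix C assume "C \<in> sets (G s)"
        \<comment> \<open>A set of \<open>G s\<close> belongs to \<open>J u\<close> for every
          \<open>u > s\<close>, which is all that the right-limit inequality asks of
          \<open>C\<close>.\<close>
        then show "(\<integral>\<^sup>+\<omega>. ennreal (Z t \<omega> * M t \<omega>) * indicator C \<omega> \<partial>P)
            \<le> (\<integral>\<^sup>+\<omega>. ennreal (Z s \<omega> * M s \<omega>) * indicator C \<omega> \<partial>P)"
          using int[OF st(1)]
          by (intro nn_integral_right_limit_mono[OF assms(1) J W st _ _ limW[OF st(1)] limW[OF t]])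
            (auto simp: sets_G[OF st(1)])
      qed
    qed (use adapted_ZM int in auto)
  qed
  then have "universal_supermartingale_density P F G Z"
    using Z_adapted Z_cadlag Z_pos by (auto simp: universal_supermartingale_density_def)
  then show ?thesis unfolding G_def by blast
qed

end
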